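(* Let $\nabla$ be a holomorphic connection on the complex torus $T_\lambda$, represented by the global $1$-form $\eta=a\,dz$ with $a\in\mathbb{C}$. Let $\sigma\colon[0,T)\to T_\lambda$ be a maximal (non-constant) geodesic for $\nabla$. If $a\neq0$, then the $\omega$-limit set of $\sigma$ is (the closure of) the projection on $T_\lambda$ of a straight line $l\colon\mathbb{R}\to\mathbb{C}$ of the form $l(t)=\bar a t+b$ for a suitable $b\in\mathbb{C}$. In particular: (1) if $\bar a\in\mathbb{R}^*(\mathbb{Z}\oplus\lambda\mathbb{Z})\setminus\{0\}$ then either $\sigma$ is closed, non-periodic, and its support is the projection of the line $l$; or $\sigma$ is not closed, but its $\omega$-limit set is a closed geodesic whose support is the projection of the line $l$; (2) if $\bar a\notin\mathbb{R}^*(\mathbb{Z}\oplus\lambda\mathbb{Z})\setminus\{0\}$ then the $\omega$-limit set of $\sigma$ is all of $T_\lambda$. If $a=0$, then $\sigma$ is the projection of a line of the form $l(t)=v_0t+b$, where $v_0=\sigma'(0)$. In particular: - if $v_0\in\mathbb{R}^+(\mathbb{Z}\oplus\lambda\mathbb{Z})$ then $\sigma$ is closed and periodic; - if $v_0\notin\mathbb{R}^+(\mathbb{Z}\oplus\lambda\mathbb{Z})$ then $\sigma$ is not closed and its $\omega$-limit set is all of $T_\lambda$.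
   Context: $\lambda\in\mathbb{C}$ with $\mathrm{Im}\,\lambda>0$; $T_\lambda=\mathbb{C}/(\mathbb{Z}\oplus\lambda\mathbb{Z})$ with covering map $\pi\colon\mathbb{C}\to T_\lambda$. Tangent vectors to $T_\lambda$ are identified with complex numbers via $\pi$. For $X=\mathbb{Z}\oplus\lambda\mathbb{Z}$, $\mathbb{R}^*X=\{rx: r\in\mathbb{R}^*,x\in X\}$ and similarly $\mathbb{R}^+X$ (with $\mathbb{R}^+$ the positive reals). A holomorphic connection on a Riemann surface $S$ is a $\mathbb{C}$-linear map $\nabla$ from (germs of) holomorphic vector fields to holomorphic $1$-forms tensored with holomorphic vector fields with $\nabla(fs)=df\otimes s+f\nabla s$. On $T_\lambda$, $\nabla$ is represented by the global form $a\,dz$ if it is the projection of the connection on $\mathbb{C}$ with $\nabla(\partial/\partial z)=a\,dz\otimes\partial/\partial z$. A geodesic is a smooth curve $\sigma$ with $\nabla_{\sigma'}\sigma'\equiv0$; for the lift $\tilde\sigma$ to $\mathbb{C}$ this reads $\tilde\sigma''+a(\tilde\sigma')^2=0$. It is maximal if it cannot be extended forward in time. A geodesic is closed if there is $l>0$ with $\sigma(l)=\sigma(0)$ and $\sigma'(l)$ a positive multiple of $\sigma'(0)$, and periodic if moreover $\sigma'(l)=\sigma'(0)$. The $\omega$-limit set of $\sigma\colon[0,T)\to T_\lambda$ is the set of limits of $\sigma(t_n)$ over sequences $t_n\to T$. *)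

theory Defs
  imports "HOL-Complex_Analysis.Complex_Analysis"
begin

definition lattice :: "complex \<Rightarrow> complex set" where
  "lattice lam = {of_int m + of_int n * lam | m n. True}"

definition torus_proj :: "complex \<Rightarrow> complex \<Rightarrow> complex set" where
  "torus_proj lam z = {z + x | x. x \<in> lattice lam}"

definition torus :: "complex \<Rightarrow> complex set set" where
  "torus lam = range (torus_proj lam)"

definition quotient_open :: "(complex \<Rightarrow> 's) \<Rightarrow> 's set \<Rightarrow> bool" where
  "quotient_open p U \<longleftrightarrow> U \<subseteq> range p \<and> open (p -` U)"

lemma istopology_quotient_open: "istopology (quotient_open p)"
proof -
  have "open (p -` \<Union>\<K>)" if "\<forall>K\<in>\<K>. open (p -` K)" for \<K>
    using that by (simp add: vimage_Union open_UN)
  then show ?thesis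
    by (auto simp: istopology_def quotient_open_def open_Int)
qed

definition torus_topology :: "complex \<Rightarrow> complex set topology" where
  "torus_topology lam = topology (quotient_open (torus_proj lam))"

lemma openin_torus_topology:
  "openin (torus_topology lam) U \<longleftrightarrow> U \<subseteq> torus lam \<and> open (torus_proj lam -` U)"
  by (simp add: torus_topology_def topology_inverse'[OF istopology_quotient_open]
      quotient_open_def torus_def)

definition real_multiples :: "real set \<Rightarrow> complex set \<Rightarrow> complex set" where
  "real_multiples R X = {of_real r * x | r x. r \<in> R \<and> x \<in> X}"

text \<open>
  The Riemann surfaces needed are the plane (\<open>p = id\<close>) and the torus (\<open>p = torus_proj lam\<close>).
  In both cases \<open>p\<close> is a covering whose deck transformations are translations, so \<open>dz\<close> and
  \<open>\<partial>/\<partial>z\<close> descend to global frames. In these frames holomorphic functions, holomorphic vector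
  fields and holomorphic sections of 1-forms tensored with vector fields over an open set \<open>U\<close> are
  all given by functions \<open>f\<close> on \<open>U\<close> with \<open>f \<circ> p\<close> holomorphic; values outside \<open>U\<close> are irrelevant.
\<close>

definition holo_section :: "(complex \<Rightarrow> 's) \<Rightarrow> 's set \<Rightarrow> ('s \<Rightarrow> complex) \<Rightarrow> bool" where
  "holo_section p U f \<longleftrightarrow> (f \<circ> p) holomorphic_on (p -` U)"

text \<open>
  A map on germs is encoded as a family of maps \<open>nabla U\<close> on sections over the open sets \<open>U\<close>,
  compatible with restriction (the second condition).
\<close>

definition holomorphic_connection ::
  "(complex \<Rightarrow> 's) \<Rightarrow> ('s set \<Rightarrow> ('s \<Rightarrow> complex) \<Rightarrow> 's \<Rightarrow> complex) \<Rightarrow> bool" where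
  "holomorphic_connection p nabla \<longleftrightarrow>
     (\<forall>U s. quotient_open p U \<longrightarrow> holo_section p U s \<longrightarrow> holo_section p U (nabla U s)) \<and>
     (\<forall>U V s u. quotient_open p U \<longrightarrow> quotient_open p V \<longrightarrow> V \<subseteq> U \<longrightarrow>
        holo_section p U s \<longrightarrow> holo_section p V u \<longrightarrow> (\<forall>q\<in>V. u q = s q) \<longrightarrow>
        (\<forall>q\<in>V. nabla V u q = nabla U s q)) \<and>
     (\<forall>U s u c d. quotient_open p U \<longrightarrow> holo_section p U s \<longrightarrow> holo_section p U u \<longrightarrow>
        (\<forall>q\<in>U. nabla U (\<lambda>q. c * s q + d * u q) q = c * nabla U s q + d * nabla U u q)) \<and>
     (\<forall>U f s z. quotient_open p U \<longrightarrow> holo_section p U f \<longrightarrow> holo_section p U s \<longrightarrow> p z \<in> U \<longrightarrow>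
        nabla U (\<lambda>q. f q * s q) (p z) = deriv (f \<circ> p) z * s (p z) + f (p z) * nabla U s (p z))"

definition represented_by ::
  "complex \<Rightarrow> (complex set set \<Rightarrow> (complex set \<Rightarrow> complex) \<Rightarrow> complex set \<Rightarrow> complex) \<Rightarrow>
   complex \<Rightarrow> bool" where
  "represented_by lam nabla a \<longleftrightarrow>
     (\<exists>nabla0. holomorphic_connection (id :: complex \<Rightarrow> complex) nabla0 \<and>
        (\<forall>z. nabla0 UNIV (\<lambda>_. 1) z = a) \<and>
        (\<forall>U s z. quotient_open (torus_proj lam) U \<longrightarrow> holo_section (torus_proj lam) U s \<longrightarrow>
           torus_proj lam z \<in> U \<longrightarrow>
           nabla U s (torus_proj lam z) =
             nabla0 (torus_proj lam -` U) (s \<circ> torus_proj lam) z))"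

definition time_interval :: "ereal \<Rightarrow> real set" where
  "time_interval T = {t. 0 \<le> t \<and> ereal t < T}"

text \<open>
  The local inverses of the projection are the charts of the torus; in the next two definitions
  \<open>g\<close> and \<open>G 0\<close> are the curve read in such a chart near \<open>t\<close>, and \<open>G k\<close> is the \<open>k\<close>-th
  derivative. Derivatives at the endpoint \<open>0\<close> are one-sided.
\<close>

definition has_velocity ::
  "complex \<Rightarrow> ereal \<Rightarrow> (real \<Rightarrow> complex set) \<Rightarrow> complex \<Rightarrow> real \<Rightarrow> bool" where
  "has_velocity lam T \<sigma> v t \<longleftrightarrow>
     (\<exists>g \<epsilon>. \<epsilon> > 0 \<and> (\<forall>s \<in> time_interval T \<inter> ball t \<epsilon>. \<sigma> s = torus_proj lam (g s)) \<and>
        (g has_vector_derivative v) (at t within time_interval T))"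

definition velocity :: "complex \<Rightarrow> ereal \<Rightarrow> (real \<Rightarrow> complex set) \<Rightarrow> real \<Rightarrow> complex" where
  "velocity lam T \<sigma> t = (THE v. has_velocity lam T \<sigma> v t)"

definition smooth_curve :: "complex \<Rightarrow> ereal \<Rightarrow> (real \<Rightarrow> complex set) \<Rightarrow> bool" where
  "smooth_curve lam T \<sigma> \<longleftrightarrow>
     (\<forall>t \<in> time_interval T. \<exists>G \<epsilon>. \<epsilon> > 0 \<and>
        (\<forall>s \<in> time_interval T \<inter> ball t \<epsilon>. \<sigma> s = torus_proj lam (G 0 s) \<and>
           (\<forall>k::nat. (G k has_vector_derivative G (Suc k) s) (at s within time_interval T))))"

text \<open>
  The covariant derivative of the vector field \<open>Y \<partial>/\<partial>z\<close> along \<open>\<sigma>\<close>: by the Leibniz rule it is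
  \<open>Y' \<partial>/\<partial>z + Y \<nabla>\<^bsub>\<sigma>'\<^esub> (\<partial>/\<partial>z)\<close>, and \<open>\<partial>/\<partial>z\<close> is the section with constant coefficient \<open>1\<close>.
\<close>

definition covariant_derivative ::
  "complex \<Rightarrow> (complex set set \<Rightarrow> (complex set \<Rightarrow> complex) \<Rightarrow> complex set \<Rightarrow> complex) \<Rightarrow>
   ereal \<Rightarrow> (real \<Rightarrow> complex set) \<Rightarrow> (real \<Rightarrow> complex) \<Rightarrow> real \<Rightarrow> complex" where
  "covariant_derivative lam nabla T \<sigma> Y t =
     vector_derivative Y (at t within time_interval T) +
     Y t * (nabla (torus lam) (\<lambda>_. 1) (\<sigma> t) * velocity lam T \<sigma> t)"

definition geodesic ::
  "complex \<Rightarrow> (complex set set \<Rightarrow> (complex set \<Rightarrow> complex) \<Rightarrow> complex set \<Rightarrow> complex) \<Rightarrow>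
   ereal \<Rightarrow> (real \<Rightarrow> complex set) \<Rightarrow> bool" where
  "geodesic lam nabla T \<sigma> \<longleftrightarrow>
     0 < T \<and> smooth_curve lam T \<sigma> \<and>
     (\<forall>t \<in> time_interval T. covariant_derivative lam nabla T \<sigma> (velocity lam T \<sigma>) t = 0)"

definition maximal_geodesic ::
  "complex \<Rightarrow> (complex set set \<Rightarrow> (complex set \<Rightarrow> complex) \<Rightarrow> complex set \<Rightarrow> complex) \<Rightarrow>
   ereal \<Rightarrow> (real \<Rightarrow> complex set) \<Rightarrow> bool" where
  "maximal_geodesic lam nabla T \<sigma> \<longleftrightarrow>
     geodesic lam nabla T \<sigma> \<and>
     \<not> (\<exists>T' \<tau>. T < T' \<and> geodesic lam nabla T' \<tau> \<and> (\<forall>t \<in> time_interval T. \<tau> t = \<sigma> t))"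

definition closed_curve :: "complex \<Rightarrow> ereal \<Rightarrow> (real \<Rightarrow> complex set) \<Rightarrow> bool" where
  "closed_curve lam T \<sigma> \<longleftrightarrow>
     (\<exists>l \<in> time_interval T. l > 0 \<and> \<sigma> l = \<sigma> 0 \<and>
        (\<exists>c::real. c > 0 \<and> velocity lam T \<sigma> l = of_real c * velocity lam T \<sigma> 0))"

definition periodic_curve :: "complex \<Rightarrow> ereal \<Rightarrow> (real \<Rightarrow> complex set) \<Rightarrow> bool" where
  "periodic_curve lam T \<sigma> \<longleftrightarrow>
     (\<exists>l \<in> time_interval T. l > 0 \<and> \<sigma> l = \<sigma> 0 \<and> velocity lam T \<sigma> l = velocity lam T \<sigma> 0)"

definition support :: "ereal \<Rightarrow> (real \<Rightarrow> complex set) \<Rightarrow> complex set set" where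
  "support T \<sigma> = \<sigma> ` time_interval T"

definition omega_limit :: "complex \<Rightarrow> ereal \<Rightarrow> (real \<Rightarrow> complex set) \<Rightarrow> complex set set" where
  "omega_limit lam T \<sigma> =
     {q. \<exists>t. (\<forall>n. t n \<in> time_interval T) \<and> (\<lambda>n. ereal (t n)) \<longlonglongrightarrow> T \<and>
         limitin (torus_topology lam) (\<lambda>n. \<sigma> (t n)) q sequentially}"

definition line :: "complex \<Rightarrow> complex \<Rightarrow> real \<Rightarrow> complex" where
  "line v b t = v * of_real t + b"

end

theory Submission imports Defs
begin

text \<open>
  Along a geodesic the velocity \<open>V\<close> satisfies the Riccati equation \<open>V' = - a V\<^sup>2\<close>, so with
  \<open>v = V 0\<close> we get \<open>V t = v / (1 + a v t)\<close>, and the lift is \<open>z0 + Ln (1 + a v t) / a\<close> (or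
  \<open>z0 + v t\<close> if \<open>a = 0\<close>). The principal logarithm suffices, because a ray from \<open>1\<close> that meets the
  nonpositive reals passes through \<open>0\<close>, where the geodesic stops. By maximality \<open>T\<close> is infinite
  unless \<open>a v\<close> is a negative real, in which case \<open>T = - 1 / (a v)\<close>. In all cases the lift has the form
  \<open>u r(t) + e(t)\<close> with \<open>r(t)\<close> tending to infinity, \<open>e(t)\<close> convergent and \<open>u\<close> a real multiple of
  \<open>cnj a\<close> (or \<open>u = v\<close> if \<open>a = 0\<close>). Hence the limit set is that of a linear flow on the torus, which is
  determined by Dirichlet's (recurrence) and Kronecker's (density) approximation theorems. For
  \<open>a v\<close> real \<open>e\<close> is constant and the geodesic runs along the line itself; for \<open>a v\<close> not real the
  direction of the velocity never recurs, so the geodesic is not closed.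
\<close>

section \<open>The topology of the torus and the end of the time interval\<close>

lemma lattice_0: "0 \<in> lattice lam"
  unfolding lattice_def by (auto intro!: exI[of _ 0])

lemma lattice_add:
  assumes "x \<in> lattice lam" "y \<in> lattice lam"
  shows "x + y \<in> lattice lam"
proof -
  obtain m n m' n' where "x = of_int m + of_int n * lam" "y = of_int m' + of_int n' * lam"
    using assms unfolding lattice_def by auto
  then have "x + y = of_int (m + m') + of_int (n + n') * lam"
    by (simp add: algebra_simps)
  then show ?thesis
    unfolding lattice_def by blast
qed

lemma lattice_of_int_mult:
  assumes "x \<in> lattice lam"
  shows "of_int k * x \<in> lattice lam"
proof -
  obtain m n where "x = of_int m + of_int n * lam"
    using assms unfolding lattice_def by auto
  then have "of_int k * x = of_int (k * m) + of_int (k * n) * lam"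
    by (simp add: algebra_simps)
  then show ?thesis
    unfolding lattice_def by blast
qed

lemma lattice_uminus: "x \<in> lattice lam \<Longrightarrow> - x \<in> lattice lam"
  using lattice_of_int_mult[of x lam "-1"] by simp

lemma lattice_diff: "x \<in> lattice lam \<Longrightarrow> y \<in> lattice lam \<Longrightarrow> x - y \<in> lattice lam"
  using lattice_add[of x lam "- y"] lattice_uminus by simp

text \<open>If \<open>n\<close> is nonzero, \<open>m + n * lam\<close> has imaginary part at least
  \<open>Im lam\<close> in absolute value; if \<open>n\<close> is zero, the point is an integer.
  This gives the separating radius \<open>min 1 (Im lam)\<close>.\<close>

lemma lattice_discrete:
  assumes "Im lam > 0"
  shows "\<exists>\<delta>>0. \<forall>x\<in>lattice lam. norm x < \<delta> \<longrightarrow> x = 0"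
proof (intro exI conjI ballI impI)
  show "min 1 (Im lam) > 0"
    using assms by simp
  fix x assume "x \<in> lattice lam" and small: "norm x < min 1 (Im lam)"
  then obtain m n where x: "x = of_int m + of_int n * lam"
    unfolding lattice_def by auto
  have n: "n = 0"
  proof (rule ccontr)
    assume "n \<noteq> 0"
    then have "1 \<le> \<bar>real_of_int n\<bar>"
      by linarith
    then have "Im lam \<le> \<bar>real_of_int n\<bar> * Im lam"
      using assms by (simp add: mult_le_cancel_right1)
    also have "\<dots> = \<bar>Im x\<bar>"
      using assms by (simp add: x abs_mult)
    also have "\<dots> \<le> norm x"
      by (rule abs_Im_le_cmod)
    finally show False
      using small by simp
  qed
  then have "norm x = \<bar>real_of_int m\<bar>"
    by (simp add: x)
  then have "m = 0"
    using small by (cases "m = 0") auto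
  with n x show "x = 0"
    by simp
qed

lemma complex_lattice_coordinates:
  assumes "Im lam > 0"
  obtains x y :: real where "z = of_real x + of_real y * lam"
proof
  show "z = of_real (Re z - Im z / Im lam * Re lam) + of_real (Im z / Im lam) * lam"
    using assms by (auto simp: complex_eq_iff)
qed

section \<open>Neighbourhoods, closures and limits in the quotient topology\<close>

lemma torus_proj_eq_iff: "torus_proj lam z = torus_proj lam w \<longleftrightarrow> z - w \<in> lattice lam"
proof
  assume "torus_proj lam z = torus_proj lam w"
  moreover have "z \<in> torus_proj lam z"
    unfolding torus_proj_def using lattice_0 by force
  ultimately have "z \<in> torus_proj lam w"
    by simp
  then show "z - w \<in> lattice lam"
    unfolding torus_proj_def by auto
next
  assume zw: "z - w \<in> lattice lam"
  show "torus_proj lam z = torus_proj lam w"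
  proof (rule set_eqI)
    fix q
    have "q - z \<in> lattice lam \<longleftrightarrow> q - w \<in> lattice lam"
      using lattice_add[OF zw, of "q - z"] lattice_diff[of "q - w" lam, OF _ zw]
      by (auto simp: algebra_simps)
    moreover have "q \<in> torus_proj lam u \<longleftrightarrow> q - u \<in> lattice lam" for u
      unfolding torus_proj_def by (auto intro!: exI[of _ "q - u"])
    ultimately show "q \<in> torus_proj lam z \<longleftrightarrow> q \<in> torus_proj lam w"
      by simp
  qed
qed

text \<open>Translates nearness on the torus into an inequality in the plane up to a lattice vector,
  the form in which all later estimates are made.\<close>

lemma torus_proj_in_ball_iff:
  "torus_proj lam z \<in> torus_proj lam ` ball w \<epsilon> \<longleftrightarrow> (\<exists>x\<in>lattice lam. norm (z + x - w) < \<epsilon>)"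
proof
  assume "torus_proj lam z \<in> torus_proj lam ` ball w \<epsilon>"
  then obtain u where u: "u \<in> ball w \<epsilon>" "u - z \<in> lattice lam"
    by (metis image_iff torus_proj_eq_iff)
  then show "\<exists>x\<in>lattice lam. norm (z + x - w) < \<epsilon>"
    by (intro bexI[of _ "u - z"]) (auto simp: dist_norm norm_minus_commute)
next
  assume "\<exists>x\<in>lattice lam. norm (z + x - w) < \<epsilon>"
  then obtain x where x: "x \<in> lattice lam" "norm (z + x - w) < \<epsilon>"
    by blast
  then have "torus_proj lam z = torus_proj lam (z + x)"
    using lattice_uminus by (simp add: torus_proj_eq_iff)
  then show "torus_proj lam z \<in> torus_proj lam ` ball w \<epsilon>"
    using x by (auto simp: dist_norm norm_minus_commute)
qed

text \<open>The saturation of \<open>S\<close> is the union of its lattice translates, so the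
  projection is an open map.\<close>

lemma openin_torus_proj_image:
  assumes "open S"
  shows "openin (torus_topology lam) (torus_proj lam ` S)"
proof -
  have "torus_proj lam -` torus_proj lam ` S = (\<Union>x\<in>lattice lam. (+) x ` S)" (is "?L = ?R")
  proof (rule set_eqI)
    fix z
    have "z \<in> ?L \<longleftrightarrow> (\<exists>u\<in>S. z - u \<in> lattice lam)"
      by (auto simp: image_iff torus_proj_eq_iff)
    also have "\<dots> \<longleftrightarrow> z \<in> ?R"
      by (force intro: rev_bexI)
    finally show "z \<in> ?L \<longleftrightarrow> z \<in> ?R" .
  qed
  then show ?thesis
    using assms by (auto simp: openin_torus_topology torus_def open_translation)
qed

lemma topspace_torus: "topspace (torus_topology lam) = torus lam"
proof
  show "topspace (torus_topology lam) \<subseteq> torus lam"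
    unfolding topspace_def by (auto simp: openin_torus_topology)
  have "openin (torus_topology lam) (torus lam)"
    using openin_torus_proj_image[of UNIV lam] by (simp add: torus_def)
  then show "torus lam \<subseteq> topspace (torus_topology lam)"
    by (rule openin_subset)
qed

text \<open>Together with the openness of the projection, this makes the projected balls a
  neighbourhood base at each point.\<close>

lemma openin_torus_contains_ball:
  assumes "openin (torus_topology lam) U" "torus_proj lam w \<in> U"
  obtains \<epsilon> where "\<epsilon> > 0" "torus_proj lam ` ball w \<epsilon> \<subseteq> U"
proof -
  have "open (torus_proj lam -` U)" "w \<in> torus_proj lam -` U"
    using assms by (auto simp: openin_torus_topology)
  then obtain \<epsilon> where "\<epsilon> > 0" "ball w \<epsilon> \<subseteq> torus_proj lam -` U"
    by (meson openE)
  then show thesis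
    using that by blast
qed

lemma in_torus_closure_iff:
  "torus_proj lam w \<in> torus_topology lam closure_of (torus_proj lam ` S) \<longleftrightarrow>
     (\<forall>\<epsilon>>0. \<exists>s\<in>S. \<exists>x\<in>lattice lam. norm (s + x - w) < \<epsilon>)"
  unfolding torus_proj_in_ball_iff[symmetric]
proof
  assume w: "torus_proj lam w \<in> torus_topology lam closure_of (torus_proj lam ` S)"
  show "\<forall>\<epsilon>>0. \<exists>s\<in>S. torus_proj lam s \<in> torus_proj lam ` ball w \<epsilon>"
  proof (intro allI impI)
    fix \<epsilon> :: real assume "\<epsilon> > 0"
    then have "torus_proj lam w \<in> torus_proj lam ` ball w \<epsilon>"
      by simp
    then show "\<exists>s\<in>S. torus_proj lam s \<in> torus_proj lam ` ball w \<epsilon>"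
      using w openin_torus_proj_image[of "ball w \<epsilon>" lam] unfolding in_closure_of
      by fastforce
  qed
next
  assume *: "\<forall>\<epsilon>>0. \<exists>s\<in>S. torus_proj lam s \<in> torus_proj lam ` ball w \<epsilon>"
  show "torus_proj lam w \<in> torus_topology lam closure_of (torus_proj lam ` S)"
    unfolding in_closure_of
  proof (intro conjI allI impI)
    show "torus_proj lam w \<in> topspace (torus_topology lam)"
      by (simp add: topspace_torus torus_def)
    fix U assume U: "torus_proj lam w \<in> U \<and> openin (torus_topology lam) U"
    obtain \<epsilon> where \<epsilon>: "\<epsilon> > 0" "torus_proj lam ` ball w \<epsilon> \<subseteq> U"
      by (rule openin_torus_contains_ball[OF U[THEN conjunct2] U[THEN conjunct1]])
    obtain s where "s \<in> S" "torus_proj lam s \<in> torus_proj lam ` ball w \<epsilon>"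
      using *[rule_format, OF \<epsilon>(1)] by (elim bexE)
    then show "\<exists>y. y \<in> torus_proj lam ` S \<and> y \<in> U"
      using subsetD[OF \<epsilon>(2)] by (intro exI[of _ "torus_proj lam s"] conjI imageI)
  qed
qed

lemma limitin_torus_iff:
  "limitin (torus_topology lam) f (torus_proj lam w) F \<longleftrightarrow>
     (\<forall>\<epsilon>>0. \<forall>\<^sub>F n in F. f n \<in> torus_proj lam ` ball w \<epsilon>)"
proof
  assume "limitin (torus_topology lam) f (torus_proj lam w) F"
  then show "\<forall>\<epsilon>>0. \<forall>\<^sub>F n in F. f n \<in> torus_proj lam ` ball w \<epsilon>"
    unfolding limitin_def by (simp add: openin_torus_proj_image)
next
  assume *: "\<forall>\<epsilon>>0. \<forall>\<^sub>F n in F. f n \<in> torus_proj lam ` ball w \<epsilon>"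
  show "limitin (torus_topology lam) f (torus_proj lam w) F"
    unfolding limitin_def
  proof (intro conjI allI impI)
    show "torus_proj lam w \<in> topspace (torus_topology lam)"
      by (simp add: topspace_torus torus_def)
    fix U assume U: "openin (torus_topology lam) U \<and> torus_proj lam w \<in> U"
    obtain \<epsilon> where \<epsilon>: "\<epsilon> > 0" "torus_proj lam ` ball w \<epsilon> \<subseteq> U"
      by (rule openin_torus_contains_ball[OF U[THEN conjunct1] U[THEN conjunct2]])
    then have "\<forall>\<^sub>F n in F. f n \<in> torus_proj lam ` ball w \<epsilon>"
      using * by blast
    then show "\<forall>\<^sub>F n in F. f n \<in> U"
      by eventually_elim (use \<epsilon> in blast)
  qed
qed

text \<open>The filter of real times tending to \<open>T\<close> from below. Pulling it back from
  the extended reals treats finite and infinite \<open>T\<close> alike: it is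
  \<open>at_left r\<close> for \<open>T = ereal r\<close> and \<open>at_top\<close> for
  \<open>T = \<infinity>\<close>.\<close>

definition time_end :: "ereal \<Rightarrow> real filter" where
  "time_end T = filtercomap ereal (at_left T)"

lemma filtercomap_filtermap_inj:
  assumes "inj f"
  shows "filtercomap f (filtermap f F) = F"
proof (rule antisym[OF _ filtercomap_filtermap], rule filter_leI)
  fix P assume "eventually P F"
  moreover have "(\<forall>y. f x = f y \<longrightarrow> P y) \<longleftrightarrow> P x" for x
    using assms by (auto simp: inj_def)
  ultimately show "eventually P (filtercomap f (filtermap f F))"
    unfolding eventually_filtercomap eventually_filtermap
    by (intro exI[of _ "\<lambda>y. \<forall>x. y = f x \<longrightarrow> P x"]) auto
qed

lemma time_end_PInf: "time_end \<infinity> = at_top"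
  unfolding time_end_def at_left_PInf by (rule filtercomap_filtermap_inj) (simp add: inj_def)

lemma time_end_ereal: "time_end (ereal r) = at_left r"
  unfolding time_end_def at_left_ereal by (rule filtercomap_filtermap_inj) (simp add: inj_def)

lemma eventually_time_end_iff:
  assumes "0 < T"
  shows "eventually P (time_end T) \<longleftrightarrow>
    (\<exists>s\<in>time_interval T. \<forall>t\<in>time_interval T. s < t \<longrightarrow> P t)"
proof
  assume "eventually P (time_end T)"
  then obtain Q where "eventually Q (at_left T)" and QP: "\<And>t. Q (ereal t) \<Longrightarrow> P t"
    unfolding time_end_def eventually_filtercomap by blast
  then obtain b where b: "b < T" "\<And>y. b < y \<Longrightarrow> y < T \<Longrightarrow> Q y"
    unfolding eventually_at_left[OF assms] by blast
  \<comment> \<open>The maximum with 0 keeps the threshold \<open>s\<close> inside the time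
    interval.\<close>
  have "max b 0 < T"
    using b assms by simp
  then obtain s where s: "max b 0 < ereal s" "ereal s < T"
    using ereal_dense2 by blast
  show "\<exists>s\<in>time_interval T. \<forall>t\<in>time_interval T. s < t \<longrightarrow> P t"
  proof (intro bexI ballI impI)
    show "s \<in> time_interval T"
      using s by (simp add: time_interval_def less_imp_le)
    fix t assume t: "t \<in> time_interval T" "s < t"
    have "b < ereal s"
      using s by simp
    also have "ereal s < ereal t"
      using t by simp
    finally show "P t"
      using t by (intro QP b) (auto simp: time_interval_def)
  qed
next
  assume "\<exists>s\<in>time_interval T. \<forall>t\<in>time_interval T. s < t \<longrightarrow> P t"
  then obtain s where s: "s \<in> time_interval T" "\<And>t. t \<in> time_interval T \<Longrightarrow> s < t \<Longrightarrow> P t"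
    by blast
  then have "eventually (\<lambda>y. \<forall>t. y = ereal t \<longrightarrow> P t) (at_left T)"
    unfolding eventually_at_left[OF assms]
    by (intro exI[of _ "ereal s"]) (auto simp: time_interval_def)
  then show "eventually P (time_end T)"
    unfolding time_end_def eventually_filtercomap by blast
qed

lemma eventually_time_end_gt:
  assumes "0 < T" "s \<in> time_interval T"
  shows "\<forall>\<^sub>F t in time_end T. s < t"
  unfolding eventually_time_end_iff[OF assms(1)] using assms(2) by blast

lemma time_end_neq_bot:
  assumes "0 < T"
  shows "time_end T \<noteq> bot"
proof -
  have "\<exists>\<^sub>F t in time_end T. True"
    unfolding frequently_def eventually_time_end_iff[OF assms]
  proof clarsimp
    fix s assume "s \<in> time_interval T"
    then have "0 \<le> s" "ereal s < T"
      by (auto simp: time_interval_def)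
    then obtain t where "ereal s < ereal t" "ereal t < T"
      using ereal_dense2 by blast
    with \<open>0 \<le> s\<close> show "\<exists>t\<in>time_interval T. s < t"
      by (intro bexI[of _ t]) (auto simp: time_interval_def)
  qed
  then show ?thesis
    by (metis eventually_bot frequently_def)
qed

section \<open>Limit sets as sets of cluster points\<close>

lemma frequently_time_end_iff:
  assumes "0 < T"
  shows "(\<exists>\<^sub>F t in time_end T. P t) \<longleftrightarrow>
    (\<forall>s\<in>time_interval T. \<exists>t\<in>time_interval T. s < t \<and> P t)"
  unfolding frequently_def eventually_time_end_iff[OF assms] by blast

text \<open>Replaces the sequential definition by a cluster point condition. This works because the
  projected balls of radius \<open>1 / (n + 1)\<close> form a countable neighbourhood base.\<close>

lemma omega_limit_iff:
  assumes "0 < T"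
  shows "torus_proj lam w \<in> omega_limit lam T \<sigma> \<longleftrightarrow>
    (\<forall>\<epsilon>>0. \<exists>\<^sub>F t in time_end T. \<sigma> t \<in> torus_proj lam ` ball w \<epsilon>)"
proof
  assume "torus_proj lam w \<in> omega_limit lam T \<sigma>"
  then obtain t where t: "\<And>n. t n \<in> time_interval T" "(\<lambda>n. ereal (t n)) \<longlonglongrightarrow> T"
    and lim: "\<And>\<epsilon>. \<epsilon> > 0 \<Longrightarrow> \<forall>\<^sub>F n in sequentially. \<sigma> (t n) \<in> torus_proj lam ` ball w \<epsilon>"
    unfolding omega_limit_def mem_Collect_eq limitin_torus_iff by metis
  show "\<forall>\<epsilon>>0. \<exists>\<^sub>F t in time_end T. \<sigma> t \<in> torus_proj lam ` ball w \<epsilon>"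
    unfolding frequently_time_end_iff[OF assms]
  proof (intro allI impI ballI)
    fix \<epsilon> :: real and s assume "\<epsilon> > 0" and "s \<in> time_interval T"
    then have "\<forall>\<^sub>F n in sequentially. ereal s < ereal (t n)"
      using t(2) by (intro order_tendstoD) (auto simp: time_interval_def)
    from eventually_conj[OF this lim[OF \<open>\<epsilon> > 0\<close>]]
    show "\<exists>t\<in>time_interval T. s < t \<and> \<sigma> t \<in> torus_proj lam ` ball w \<epsilon>"
      using t(1) by (auto simp: eventually_sequentially)
  qed
next
  assume *: "\<forall>\<epsilon>>0. \<exists>\<^sub>F t in time_end T. \<sigma> t \<in> torus_proj lam ` ball w \<epsilon>"
  obtain u where u: "\<And>n. u n < T" "u \<longlonglongrightarrow> T"
    using approx_from_below_dense_linorder[OF assms] by blast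
  \<comment> \<open>Diagonal choice: the \<open>n\<close>-th time lies beyond \<open>u n\<close>,
    which forces convergence to \<open>T\<close>, while its image lies in the \<open>n\<close>-th
    ball.\<close>
  have "\<exists>t\<in>time_interval T. u n < ereal t \<and> \<sigma> t \<in> torus_proj lam ` ball w (inverse (Suc n))" for n
  proof -
    have "\<exists>\<^sub>F t in time_end T. \<sigma> t \<in> torus_proj lam ` ball w (inverse (Suc n))"
      using * by simp
    moreover obtain s where "max (u n) 0 < ereal s" "ereal s < T"
      using ereal_dense2[of "max (u n) 0" T] u(1) assms by auto
    moreover from this have "s \<in> time_interval T" "u n < ereal s"
      by (auto simp: time_interval_def less_imp_le)
    ultimately show ?thesis
      unfolding frequently_time_end_iff[OF assms]
      by (metis less_ereal.simps(1) order.strict_trans)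
  qed
  then obtain t where t: "\<And>n. t n \<in> time_interval T" "\<And>n. u n < ereal (t n)"
    "\<And>n. \<sigma> (t n) \<in> torus_proj lam ` ball w (inverse (Suc n))"
    by metis
  have "(\<lambda>n. ereal (t n)) \<longlonglongrightarrow> T"
  proof (rule tendsto_sandwich[OF _ _ u(2) tendsto_const])
    show "\<forall>\<^sub>F n in sequentially. u n \<le> ereal (t n)"
      using t(2) by (simp add: less_imp_le)
    show "\<forall>\<^sub>F n in sequentially. ereal (t n) \<le> T"
      using t(1) by (simp add: time_interval_def less_imp_le)
  qed
  moreover have "limitin (torus_topology lam) (\<lambda>n. \<sigma> (t n)) (torus_proj lam w) sequentially"
    unfolding limitin_torus_iff
  proof (intro allI impI)
    fix \<epsilon> :: real assume "\<epsilon> > 0"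
    then have "\<forall>\<^sub>F n in sequentially. inverse (real (Suc n)) < \<epsilon>"
      by (rule order_tendstoD(2)[OF LIMSEQ_inverse_real_of_nat])
    then show "\<forall>\<^sub>F n in sequentially. \<sigma> (t n) \<in> torus_proj lam ` ball w \<epsilon>"
    proof eventually_elim
      case (elim n)
      then have "ball w (inverse (Suc n)) \<subseteq> ball w \<epsilon>"
        by (intro subset_ball) simp
      then show ?case
        using t(3)[of n] by blast
    qed
  qed
  ultimately show "torus_proj lam w \<in> omega_limit lam T \<sigma>"
    unfolding omega_limit_def using t(1) by blast
qed

section \<open>Linear flows on the torus\<close>

text \<open>Simultaneous Dirichlet approximation of the two lattice coordinates of
  \<open>K * u\<close>: a positive integer \<open>q\<close> brings both multiples close to integers,
  and \<open>\<rho> = q * K\<close> is the return time.\<close>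

lemma line_recurrence:
  assumes "Im lam > 0" and "\<epsilon> > 0"
  obtains \<rho> x where "M \<le> \<rho>" "x \<in> lattice lam" "norm (of_real \<rho> * u + x) < \<epsilon>"
proof -
  obtain \<alpha> \<beta> where u: "u = of_real \<alpha> + of_real \<beta> * lam"
    using complex_lattice_coordinates[OF assms(1)] .
  \<comment> \<open>Dirichlet's theorem gives only \<open>q \<ge> 1\<close>; the rescaling by
    \<open>K\<close> makes the return time at least \<open>M\<close>, and the 1 keeps
    \<open>K\<close> positive.\<close>
  define K where "K = max 1 M"
  \<comment> \<open>If both lattice coordinates are at most \<open>\<delta>\<close> in absolute
    value, the norm is at most \<open>c * \<delta>\<close>.\<close>
  define c where "c = 1 + norm lam"
  have "c > 0"
    unfolding c_def by (simp add: add_pos_nonneg)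
  obtain N :: nat where N: "N > 0" "inverse (real N) < \<epsilon> / c"
    using ex_inverse_of_nat_less[of "\<epsilon> / c"] \<open>c > 0\<close> assms(2) by auto
  define \<theta> where "\<theta> i = (if i = 0 then K * \<alpha> else K * \<beta>)" for i :: nat
  obtain q p where q: "0 < q" and qp: "\<And>i. i < 2 \<Longrightarrow> \<bar>of_int q * \<theta> i - of_int (p i)\<bar> < 1 / N"
    using Dirichlet_approx_simult[OF N(1), of 2 \<theta>] by metis
  define x where "x = - (of_int (p 0) + of_int (p 1) * lam)"
  have "x \<in> lattice lam"
    unfolding x_def by (rule lattice_uminus) (auto simp: lattice_def)
  have "of_real (of_int q * K) * u + x
      = of_real (of_int q * \<theta> 0 - of_int (p 0)) + of_real (of_int q * \<theta> 1 - of_int (p 1)) * lam"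
    by (simp add: u x_def \<theta>_def algebra_simps)
  also have "norm \<dots> \<le> \<bar>of_int q * \<theta> 0 - of_int (p 0)\<bar> + \<bar>of_int q * \<theta> 1 - of_int (p 1)\<bar> * norm lam"
    by (rule order_trans[OF norm_triangle_ineq]) (simp only: norm_mult norm_of_real order_refl)
  also have "\<dots> \<le> 1 / N + 1 / N * norm lam"
    using qp[of 0] qp[of 1] by (intro add_mono mult_right_mono) auto
  also have "\<dots> = inverse (real N) * c"
    by (simp add: c_def divide_inverse algebra_simps)
  also have "\<dots> < \<epsilon>"
    using N(2) \<open>c > 0\<close> by (simp add: pos_less_divide_eq)
  finally have "norm (of_real (of_int q * K) * u + x) < \<epsilon>" .
  moreover have "M \<le> of_int q * K"
  proof -
    have "1 * K \<le> of_int q * K"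
      using q by (intro mult_right_mono) (auto simp: K_def)
    then show ?thesis
      by (simp add: K_def)
  qed
  ultimately show thesis
    using that \<open>x \<in> lattice lam\<close> by blast
qed

section \<open>Curves asymptotic to a line\<close>

lemma time_interval_Icc: "t \<in> time_interval T \<Longrightarrow> 0 \<le> s \<Longrightarrow> {s..t} \<subseteq> time_interval T"
  unfolding time_interval_def using order.strict_trans1[of "ereal _" "ereal t" T] by auto

lemma time_end_in_interval:
  assumes "0 < T"
  shows "\<forall>\<^sub>F t in time_end T. t \<in> time_interval T"
  unfolding eventually_time_end_iff[OF assms]
  by (rule bexI[of _ 0]) (use assms in \<open>auto simp: time_interval_def zero_ereal_def\<close>)

text \<open>Divergence of \<open>r\<close> supplies a later time with value at least
  \<open>\<rho>\<close>; the intermediate value theorem applies on the compact interval in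
  between.\<close>

lemma time_end_intermediate_value:
  fixes r :: "real \<Rightarrow> real"
  assumes "0 < T" "s \<in> time_interval T"
    and "continuous_on (time_interval T) r" "filterlim r at_top (time_end T)" "r s \<le> \<rho>"
  obtains t where "t \<in> time_interval T" "s \<le> t" "r t = \<rho>"
proof -
  have "\<forall>\<^sub>F t in time_end T. \<rho> \<le> r t \<and> s < t \<and> t \<in> time_interval T"
    using assms(4)[unfolded filterlim_at_top, rule_format] assms(1,2)
    by (intro eventually_conj eventually_time_end_gt time_end_in_interval)
  then obtain t' where t': "\<rho> \<le> r t'" "s < t'" "t' \<in> time_interval T"
    using eventually_happens'[OF time_end_neq_bot[OF assms(1)]] by blast
  have "{s..t'} \<subseteq> time_interval T"
    using t' assms(2) by (intro time_interval_Icc) (auto simp: time_interval_def)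
  then obtain t where "s \<le> t" "t \<le> t'" "r t = \<rho>"
    using IVT'[of r s \<rho> t'] assms t' continuous_on_subset by (metis less_imp_le)
  with \<open>{s..t'} \<subseteq> time_interval T\<close> show thesis
    using that by auto
qed

text \<open>
  By recurrence of the linear flow the curve returns close to every point of the whole line,
  although it follows the line in one direction only.
\<close>

lemma omega_limit_asymptotic_line:
  assumes "Im lam > 0" and "0 < T"
    and \<sigma>: "\<And>t. t \<in> time_interval T \<Longrightarrow> \<sigma> t = torus_proj lam (u * of_real (r t) + e t)"
    and r: "continuous_on (time_interval T) r" "filterlim r at_top (time_end T)"
    and e: "(e \<longlongrightarrow> b) (time_end T)"
  shows "omega_limit lam T \<sigma> = torus_topology lam closure_of (torus_proj lam ` range (line u b))"
proof -
  have *: "torus_proj lam w \<in> omega_limit lam T \<sigma> \<longleftrightarrow>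
    torus_proj lam w \<in> torus_topology lam closure_of (torus_proj lam ` range (line u b))" for w
    unfolding omega_limit_iff[OF assms(2)] in_torus_closure_iff
  proof (intro iffI allI impI)
    fix \<epsilon> :: real assume "\<epsilon> > 0"
    assume "\<forall>\<epsilon>>0. \<exists>\<^sub>F t in time_end T. \<sigma> t \<in> torus_proj lam ` ball w \<epsilon>"
    then have "\<exists>\<^sub>F t in time_end T. \<sigma> t \<in> torus_proj lam ` ball w (\<epsilon> / 2)"
      using \<open>\<epsilon> > 0\<close> by simp
    moreover have "\<forall>\<^sub>F t in time_end T. dist (e t) b < \<epsilon> / 2 \<and> t \<in> time_interval T"
      using tendstoD[OF e, of "\<epsilon> / 2"] time_end_in_interval[OF assms(2)] \<open>\<epsilon> > 0\<close>
      by (intro eventually_conj) auto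
    ultimately have "\<exists>\<^sub>F t in time_end T. \<sigma> t \<in> torus_proj lam ` ball w (\<epsilon> / 2) \<and>
        dist (e t) b < \<epsilon> / 2 \<and> t \<in> time_interval T"
      by (rule frequently_eventually_frequently)
    then obtain t where t: "\<sigma> t \<in> torus_proj lam ` ball w (\<epsilon> / 2)" "dist (e t) b < \<epsilon> / 2"
      "t \<in> time_interval T"
      by (auto elim!: frequentlyE)
    then obtain x where x: "x \<in> lattice lam" "norm (u * of_real (r t) + e t + x - w) < \<epsilon> / 2"
      using \<sigma> by (auto simp: torus_proj_in_ball_iff)
    have "norm (line u b (r t) + x - w)
        \<le> norm (u * of_real (r t) + e t + x - w) + norm (e t - b)"
      using norm_triangle_ineq4[of "u * of_real (r t) + e t + x - w" "e t - b"]
      by (simp add: line_def algebra_simps)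
    also have "\<dots> < \<epsilon>"
      using x t by (simp add: dist_norm)
    finally show "\<exists>s\<in>range (line u b). \<exists>x\<in>lattice lam. norm (s + x - w) < \<epsilon>"
      using x by blast
  next
    fix \<epsilon> :: real assume "\<epsilon> > 0"
    then have \<epsilon>3: "\<epsilon> / 3 > 0"
      by simp
    assume "\<forall>\<epsilon>>0. \<exists>s\<in>range (line u b). \<exists>x\<in>lattice lam. norm (s + x - w) < \<epsilon>"
    then obtain s0 x0 where x0: "x0 \<in> lattice lam" "norm (line u b s0 + x0 - w) < \<epsilon> / 3"
      using \<epsilon>3 by blast
    show "\<exists>\<^sub>F t in time_end T. \<sigma> t \<in> torus_proj lam ` ball w \<epsilon>"
      unfolding frequently_time_end_iff[OF assms(2)]
    proof (intro ballI)
      fix s assume s: "s \<in> time_interval T"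
      have "\<forall>\<^sub>F t in time_end T. dist (e t) b < \<epsilon> / 3"
        using tendstoD[OF e \<epsilon>3] .
      then obtain s1 where s1: "s1 \<in> time_interval T"
        "\<And>t. t \<in> time_interval T \<Longrightarrow> s1 < t \<Longrightarrow> dist (e t) b < \<epsilon> / 3"
        unfolding eventually_time_end_iff[OF assms(2)] by blast
      \<comment> \<open>After \<open>s2\<close> the time is late enough and the error
        \<open>e\<close> is within \<open>\<epsilon> / 3\<close> of its limit.\<close>
      define s2 where "s2 = max s s1"
      have s2: "s2 \<in> time_interval T"
        using s s1 by (auto simp: s2_def max_def)
      \<comment> \<open>The target parameter \<open>s0 + \<rho>\<close> differs from
        \<open>s0\<close> by an almost-period of the flow. The summand 1 puts it strictly above
        \<open>r s2\<close>, so the time found below is strictly later than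
        \<open>s2\<close>.\<close>
      obtain \<rho> x where \<rho>: "r s2 - s0 + 1 \<le> \<rho>" "x \<in> lattice lam" "norm (of_real \<rho> * u + x) < \<epsilon> / 3"
        using line_recurrence[OF assms(1) \<epsilon>3] .
      obtain t where t: "t \<in> time_interval T" "s2 \<le> t" "r t = s0 + \<rho>"
        using time_end_intermediate_value[OF assms(2) s2 r, of "s0 + \<rho>"] \<rho> by auto
      have "t \<noteq> s2"
        using t(3) \<rho>(1) by auto
      with t have "s2 < t"
        by simp
      then have "s1 < t" "s < t"
        by (auto simp: s2_def)
      \<comment> \<open>Three errors of size \<open>\<epsilon> / 3\<close>: the point of the line at
        \<open>s0\<close>, the recurrence of the flow, and the distance of \<open>e t\<close> from
        its limit.\<close>
      have "u * of_real (r t) + e t + (x0 + x) - w =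
          (line u b s0 + x0 - w) + (of_real \<rho> * u + x) + (e t - b)"
        by (simp add: t(3) line_def algebra_simps)
      also have "norm \<dots> \<le> norm (line u b s0 + x0 - w) + norm (of_real \<rho> * u + x) + norm (e t - b)"
        by (intro norm_triangle_le add_right_mono norm_triangle_ineq)
      also have "\<dots> < \<epsilon>"
        using x0 \<rho> s1(2)[OF t(1) \<open>s1 < t\<close>] by (simp add: dist_norm)
      finally have "\<sigma> t \<in> torus_proj lam ` ball w \<epsilon>"
        unfolding \<sigma>[OF t(1)] torus_proj_in_ball_iff using lattice_add[OF x0(1) \<rho>(2)] by blast
      then show "\<exists>t\<in>time_interval T. s < t \<and> \<sigma> t \<in> torus_proj lam ` ball w \<epsilon>"
        using t(1) \<open>s < t\<close> by (intro bexI[of _ t] conjI)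
    qed
  qed
  have "omega_limit lam T \<sigma> \<subseteq> torus lam"
    unfolding omega_limit_def by (auto simp: limitin_def topspace_torus)
  moreover have "torus_topology lam closure_of (torus_proj lam ` range (line u b)) \<subseteq> torus lam"
    using closure_of_subset_topspace[of "torus_topology lam"] by (simp add: topspace_torus)
  ultimately show ?thesis
    using * unfolding torus_def by blast
qed

text \<open>In the real basis \<open>1\<close>, \<open>lam\<close> the slope
  \<open>\<alpha> / \<beta>\<close> is irrational: if \<open>\<beta> = 0\<close> or the slope were
  \<open>m / n\<close>, then \<open>u\<close> would be a real multiple of \<open>1\<close> or of
  \<open>m + n * lam\<close>. Kronecker's theorem then gives density.\<close>

lemma torus_line_dense:
  assumes "Im lam > 0" "u \<noteq> 0" "u \<notin> real_multiples (- {0}) (lattice lam)"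
  shows "torus_topology lam closure_of (torus_proj lam ` range (line u b)) = torus lam"
proof
  show "torus_topology lam closure_of (torus_proj lam ` range (line u b)) \<subseteq> torus lam"
    using closure_of_subset_topspace[of "torus_topology lam"] by (simp add: topspace_torus)
  obtain \<alpha> \<beta> where u: "u = of_real \<alpha> + of_real \<beta> * lam"
    using complex_lattice_coordinates[OF assms(1)] .
  have not_mult: "\<beta> = 0 \<or> \<alpha> / \<beta> \<notin> \<rat>"
  proof (rule ccontr)
    assume "\<not> (\<beta> = 0 \<or> \<alpha> / \<beta> \<notin> \<rat>)"
    then have "\<beta> \<noteq> 0" "\<alpha> / \<beta> \<in> \<rat>"
      by auto
    then obtain m n :: int where mn: "n \<noteq> 0" "\<alpha> / \<beta> = of_int m / of_int n"
      by (metis Rats_cases' of_int_0_less_iff less_irrefl)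
    then have "\<alpha> = \<beta> / of_int n * of_int m"
      using \<open>\<beta> \<noteq> 0\<close> by (simp add: field_simps)
    then have "u = of_real (\<beta> / of_int n) * (of_int m + of_int n * lam)"
      using mn by (simp add: u algebra_simps)
    moreover have "\<beta> / of_int n \<noteq> 0"
      using \<open>\<beta> \<noteq> 0\<close> mn by simp
    ultimately have "u \<in> real_multiples (- {0}) (lattice lam)"
      unfolding real_multiples_def lattice_def by blast
    with assms show False
      by blast
  qed
  have "\<beta> \<noteq> 0"
  proof
    assume "\<beta> = 0"
    then have "u = of_real \<alpha> * (of_int 1 + of_int 0 * lam)" "\<alpha> \<noteq> 0"
      using u assms by auto
    then have "u \<in> real_multiples (- {0}) (lattice lam)"
      unfolding real_multiples_def lattice_def by blast
    with assms show False
      by blast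
  qed
  define \<theta> where "\<theta> = \<alpha> / \<beta>"
  have irr: "\<theta> \<notin> \<rat>"
    using not_mult \<open>\<beta> \<noteq> 0\<close> by (simp add: \<theta>_def)
  have "torus_proj lam w \<in> torus_topology lam closure_of (torus_proj lam ` range (line u b))" for w
    unfolding in_torus_closure_iff
  proof (intro allI impI)
    fix \<epsilon> :: real assume "\<epsilon> > 0"
    obtain w1 w2 where w: "w - b = of_real w1 + of_real w2 * lam"
      using complex_lattice_coordinates[OF assms(1)] .
    \<comment> \<open>When the second coordinate is \<open>w2 + k\<close>, the first is
      \<open>(w2 + k) * \<theta>\<close>; modulo integers it must approach \<open>w1\<close>. Hence
      the value to be approximated is \<open>w1 - w2 * \<theta>\<close>.\<close>
    obtain h k :: int where hk: "\<bar>of_int k * \<theta> - of_int h - (w1 - w2 * \<theta>)\<bar> < \<epsilon>"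
      using sequence_of_fractional_parts_is_dense[OF irr \<open>\<epsilon> > 0\<close>] by metis
    \<comment> \<open>At this parameter the second coordinate matches exactly after the translation
      by \<open>x\<close>, so only a real error remains.\<close>
    define s where "s = (w2 + of_int k) / \<beta>"
    define x where "x = of_int (- h) + of_int (- k) * lam"
    have "u * of_real s = of_real (\<alpha> * s) + of_real (\<beta> * s) * lam"
      by (simp add: u algebra_simps)
    moreover have "\<alpha> * s = (w2 + of_int k) * \<theta>" "\<beta> * s = w2 + of_int k"
      using \<open>\<beta> \<noteq> 0\<close> by (auto simp: s_def \<theta>_def field_simps)
    ultimately have "u * of_real s + x - (w - b) = of_real (of_int k * \<theta> - of_int h - (w1 - w2 * \<theta>))"
      by (simp add: w x_def algebra_simps)
    then have "line u b s + x - w = of_real (of_int k * \<theta> - of_int h - (w1 - w2 * \<theta>))"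
      by (simp add: line_def add.commute[of _ x] diff_diff_eq2 algebra_simps)
    then have "norm (line u b s + x - w) < \<epsilon>"
      using hk by (simp only: norm_of_real)
    moreover have "x \<in> lattice lam"
      unfolding x_def lattice_def by blast
    ultimately show "\<exists>s\<in>range (line u b). \<exists>x\<in>lattice lam. norm (s + x - w) < \<epsilon>"
      by blast
  qed
  then show "torus lam \<subseteq> torus_topology lam closure_of (torus_proj lam ` range (line u b))"
    unfolding torus_def by blast
qed

section \<open>Lines that close up on the torus\<close>

lemma torus_line_periodic:
  assumes "k > 0" "u * of_real k \<in> lattice lam"
  shows "torus_proj lam ` line u b ` {0..k} = torus_proj lam ` range (line u b)"
proof
  show "torus_proj lam ` range (line u b) \<subseteq> torus_proj lam ` line u b ` {0..k}"
  proof clarify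
    fix s
    \<comment> \<open>The number of whole periods to remove from \<open>s\<close>.\<close>
    define m where "m = \<lfloor>s / k\<rfloor>"
    define s' where "s' = s - of_int m * k"
    have "of_int m \<le> s / k" "s / k < of_int m + 1"
      unfolding m_def by linarith+
    then have "s' \<in> {0..k}"
      using assms(1) by (simp add: s'_def field_simps)
    moreover have "line u b s - line u b s' = of_int m * (u * of_real k)"
      by (simp add: line_def s'_def algebra_simps)
    then have "torus_proj lam (line u b s) = torus_proj lam (line u b s')"
      using lattice_of_int_mult[OF assms(2), of m] by (simp add: torus_proj_eq_iff)
    ultimately show "torus_proj lam (line u b s) \<in> torus_proj lam ` line u b ` {0..k}"
      by simp
  qed
qed auto

lemma closed_lattice:
  assumes "Im lam > 0"
  shows "closed (lattice lam)"
proof -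
  obtain \<delta> where \<delta>: "\<delta> > 0" "\<And>x. x \<in> lattice lam \<Longrightarrow> norm x < \<delta> \<Longrightarrow> x = 0"
    using lattice_discrete[OF assms] by blast
  show ?thesis
    by (rule discrete_imp_closed[OF \<delta>(1)]) (use \<delta>(2) lattice_diff in \<open>force simp: dist_norm\<close>)
qed

text \<open>One period already covers the projected line, and the preimage of that arc is the sum
  \<open>P\<close> of a compact segment and the closed lattice, hence closed.\<close>

lemma torus_line_closed:
  assumes "Im lam > 0" "k > 0" "u * of_real k \<in> lattice lam"
  shows "torus_topology lam closure_of (torus_proj lam ` range (line u b)) =
    torus_proj lam ` range (line u b)"
proof
  let ?S = "line u b ` {0..k}"
  have "torus_proj lam w \<in> torus_proj lam ` ?S"
    if w: "torus_proj lam w \<in> torus_topology lam closure_of (torus_proj lam ` ?S)" for w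
  proof -
    define P where "P = (\<Union>s\<in>?S. \<Union>x\<in>lattice lam. {s + x})"
    have "continuous_on {0..k} (line u b)"
      unfolding line_def by (intro continuous_intros)
    then have "compact ?S"
      by (rule compact_continuous_image) simp
    then have "closed P"
      unfolding P_def using closed_lattice[OF assms(1)] by (rule compact_closed_sums)
    moreover have "\<exists>y\<in>P. dist y w < \<epsilon>" if \<epsilon>: "\<epsilon> > 0" for \<epsilon>
    proof -
      obtain s x where "s \<in> ?S" "x \<in> lattice lam" "norm (s + x - w) < \<epsilon>"
        using w[unfolded in_torus_closure_iff, rule_format, OF \<epsilon>] by (elim bexE)
      then show ?thesis
        unfolding P_def by (intro bexI[of _ "s + x"] UN_I[of s] UN_I[of x]) (auto simp only: dist_norm)
    qed
    ultimately have "w \<in> P"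
      using closed_approachable[of P w] by simp
    then obtain s x where "s \<in> ?S" "x \<in> lattice lam" "w = s + x"
      unfolding P_def by (elim UN_E singletonE)
    then have "torus_proj lam w = torus_proj lam s"
      by (simp add: torus_proj_eq_iff)
    with \<open>s \<in> ?S\<close> show ?thesis
      by simp
  qed
  moreover have "torus_topology lam closure_of (torus_proj lam ` ?S) \<subseteq> range (torus_proj lam)"
    using closure_of_subset_topspace[of "torus_topology lam"] by (simp add: topspace_torus torus_def)
  ultimately show "torus_topology lam closure_of (torus_proj lam ` range (line u b)) \<subseteq>
      torus_proj lam ` range (line u b)"
    unfolding torus_line_periodic[OF assms(2,3), symmetric] by blast
  show "torus_proj lam ` range (line u b) \<subseteq>
      torus_topology lam closure_of (torus_proj lam ` range (line u b))"
    by (rule closure_of_subset) (auto simp: topspace_torus torus_def)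
qed

section \<open>The geodesic equation\<close>

lemma convex_time_interval: "convex (time_interval T)"
  unfolding is_interval_convex_1[symmetric] is_interval_1
  using time_interval_Icc[of _ T] by (fastforce simp: time_interval_def)

lemma zero_in_time_interval: "0 < T \<Longrightarrow> 0 \<in> time_interval T"
  by (simp add: time_interval_def zero_ereal_def)

text \<open>Makes derivatives within the interval unique, including the one-sided one at 0.\<close>

lemma at_within_time_interval_neq_bot:
  assumes "t \<in> time_interval T"
  shows "at t within time_interval T \<noteq> bot"
proof -
  have "0 \<le> t" "ereal t < T"
    using assms by (auto simp: time_interval_def)
  then obtain s where s: "ereal t < ereal s" "ereal s < T"
    using ereal_dense2 by blast
  then have "{t..s} \<subseteq> time_interval T"
    using \<open>0 \<le> t\<close> by (intro time_interval_Icc) (auto simp: time_interval_def)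
  moreover have "t islimpt {t..s}"
    using s by simp
  ultimately have "t islimpt time_interval T"
    by (metis islimpt_subset)
  then show ?thesis
    by (simp add: trivial_limit_within)
qed

text \<open>Two local lifts differ by lattice points, and by discreteness this difference is
  constant near \<open>t\<close>, so its derivative vanishes. This justifies the definite
  description in \<open>velocity\<close>.\<close>

lemma has_velocity_unique:
  assumes "Im lam > 0" "t \<in> time_interval T"
    and "has_velocity lam T \<sigma> v t" "has_velocity lam T \<sigma> v' t"
  shows "v = v'"
proof -
  obtain g \<epsilon> where g: "\<epsilon> > 0" "\<And>s. s \<in> time_interval T \<inter> ball t \<epsilon> \<Longrightarrow> \<sigma> s = torus_proj lam (g s)"
    "(g has_vector_derivative v) (at t within time_interval T)"
    using assms(3) unfolding has_velocity_def by blast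
  obtain g' \<epsilon>' where g': "\<epsilon>' > 0" "\<And>s. s \<in> time_interval T \<inter> ball t \<epsilon>' \<Longrightarrow> \<sigma> s = torus_proj lam (g' s)"
    "(g' has_vector_derivative v') (at t within time_interval T)"
    using assms(4) unfolding has_velocity_def by blast
  obtain \<delta> where \<delta>: "\<delta> > 0" "\<And>x. x \<in> lattice lam \<Longrightarrow> norm x < \<delta> \<Longrightarrow> x = 0"
    using lattice_discrete[OF assms(1)] by blast
  define d where "d s = g s - g' s" for s
  have d: "(d has_vector_derivative (v - v')) (at t within time_interval T)"
    unfolding d_def by (intro has_vector_derivative_diff g g')
  then have "continuous (at t within time_interval T) d"
    by (rule has_vector_derivative_continuous)
  then obtain \<eta> where \<eta>: "\<eta> > 0" "\<And>s. s \<in> time_interval T \<Longrightarrow> dist s t < \<eta> \<Longrightarrow> dist (d s) (d t) < \<delta>"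
    unfolding continuous_within_eps_delta using \<delta>(1) by blast
  have lat: "d s \<in> lattice lam" if "s \<in> time_interval T \<inter> ball t (min \<epsilon> \<epsilon>')" for s
  proof -
    have "torus_proj lam (g s) = torus_proj lam (g' s)"
      using g(2)[of s] g'(2)[of s] that by auto
    then show ?thesis
      by (simp add: d_def torus_proj_eq_iff)
  qed
  have "t \<in> time_interval T \<inter> ball t (min \<epsilon> \<epsilon>')"
    using assms(2) g(1) g'(1) by simp
  note lat_t = lat[OF this]
  define \<rho> where "\<rho> = min \<eta> (min \<epsilon> \<epsilon>')"
  \<comment> \<open>Continuity of \<open>d\<close> at \<open>t\<close> makes
    \<open>d s - d t\<close> a lattice vector shorter than \<open>\<delta>\<close>.\<close>
  have const: "d s = d t" if "s \<in> time_interval T" "dist s t < \<rho>" for s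
  proof -
    have "d s - d t \<in> lattice lam"
      using that by (intro lattice_diff lat_t lat) (auto simp: \<rho>_def dist_commute)
    then have "d s - d t = 0"
      by (rule \<delta>(2)) (use \<eta>(2)[of s] that in \<open>auto simp: \<rho>_def dist_norm\<close>)
    then show ?thesis
      by simp
  qed
  have "\<rho> > 0"
    using \<eta> g g' by (simp add: \<rho>_def)
  have "(d has_vector_derivative 0) (at t within time_interval T)"
    by (rule has_vector_derivative_transform_within[OF has_vector_derivative_const \<open>\<rho> > 0\<close> assms(2)])
      (rule const[symmetric])
  then have "v - v' = 0"
    using d vector_derivative_within[OF at_within_time_interval_neq_bot[OF assms(2)]] by metis
  then show ?thesis
    by simp
qed

lemma velocity_eq:
  assumes "Im lam > 0" "t \<in> time_interval T" "has_velocity lam T \<sigma> v t"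
  shows "velocity lam T \<sigma> t = v"
  unfolding velocity_def using has_velocity_unique[OF assms(1,2)] assms(3) by (intro the_equality)

text \<open>The geodesic equation evaluates \<open>nabla\<close> only on the global frame. Its
  domain pulls back to the whole plane, where the representing connection has the coefficient
  \<open>a\<close>.\<close>

lemma nabla_constant_section:
  assumes "represented_by lam nabla a"
  shows "nabla (torus lam) (\<lambda>_. 1) (torus_proj lam z) = a"
proof -
  have "torus_proj lam -` torus lam = UNIV"
    by (auto simp: torus_def)
  moreover have "quotient_open (torus_proj lam) (torus lam)"
    by (simp add: quotient_open_def calculation) (simp add: torus_def)
  moreover have "holo_section (torus_proj lam) (torus lam) (\<lambda>_. 1)"
    by (simp add: holo_section_def comp_def)
  moreover have "torus_proj lam z \<in> torus lam"
    by (simp add: torus_def)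
  ultimately show ?thesis
    using assms unfolding represented_by_def by (auto simp: comp_def)
qed

section \<open>From geodesics to lifted curves\<close>

lemma smooth_curve_in_torus:
  assumes "smooth_curve lam T \<sigma>" "t \<in> time_interval T"
  obtains z where "\<sigma> t = torus_proj lam z"
proof -
  obtain G \<epsilon> where "\<epsilon> > 0" "\<forall>s \<in> time_interval T \<inter> ball t \<epsilon>. \<sigma> s = torus_proj lam (G (0::nat) s)"
    using assms unfolding smooth_curve_def by blast
  then show thesis
    using that assms(2) by auto
qed

text \<open>In a chart the velocity is the first derivative of the local lift, so the vanishing
  covariant derivative becomes the Riccati equation. The lift \<open>g\<close> is kept for
  recovering the curve from its velocity.\<close>

lemma geodesic_ode:
  assumes "Im lam > 0" "represented_by lam nabla a" "geodesic lam nabla T \<sigma>" "t \<in> time_interval T"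
  defines "V \<equiv> velocity lam T \<sigma>"
  obtains g \<epsilon> where "\<epsilon> > 0" "\<And>s. s \<in> time_interval T \<inter> ball t \<epsilon> \<Longrightarrow> \<sigma> s = torus_proj lam (g s)"
    "\<And>s. s \<in> time_interval T \<inter> ball t \<epsilon> \<Longrightarrow> (g has_vector_derivative V s) (at s within time_interval T)"
    "(V has_vector_derivative - a * (V t)\<^sup>2) (at t within time_interval T)"
proof -
  obtain G \<epsilon> where "\<epsilon> > 0" and G: "\<And>s. s \<in> time_interval T \<inter> ball t \<epsilon> \<Longrightarrow> \<sigma> s = torus_proj lam (G 0 s)"
    "\<And>s k. s \<in> time_interval T \<inter> ball t \<epsilon> \<Longrightarrow>
       (G k has_vector_derivative G (Suc k) s) (at s within time_interval T)"
    using assms unfolding geodesic_def smooth_curve_def by blast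
  have V: "V s = G 1 s" if s: "s \<in> time_interval T \<inter> ball t \<epsilon>" for s
    unfolding V_def
  proof (rule velocity_eq)
    \<comment> \<open>The velocity at \<open>s\<close> requires a chart on a ball centred at
      \<open>s\<close> instead of \<open>t\<close>.\<close>
    obtain \<epsilon>' where "\<epsilon>' > 0" "ball s \<epsilon>' \<subseteq> ball t \<epsilon>"
      using s openE[OF open_ball, of s t \<epsilon>] by blast
    then show "has_velocity lam T \<sigma> (G 1 s) s"
      unfolding has_velocity_def using G(1) G(2)[OF s, of 0]
      by (intro exI[of _ "G 0"] exI[of _ \<epsilon>']) auto
  qed (use assms s in auto)
  have t: "t \<in> time_interval T \<inter> ball t \<epsilon>"
    using assms \<open>\<epsilon> > 0\<close> by simp
  have VG: "(V has_vector_derivative G 2 t) (at t within time_interval T)"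
    by (rule has_vector_derivative_transform_within[where f = "G 1" and d = \<epsilon>])
      (use G(2)[OF t, of 1] V \<open>\<epsilon> > 0\<close> assms(4) in \<open>auto simp: numeral_2_eq_2 dist_commute\<close>)
  have "nabla (torus lam) (\<lambda>_. 1) (\<sigma> t) = a"
    using nabla_constant_section[OF assms(2)] G(1)[OF t] by simp
  then have "vector_derivative V (at t within time_interval T) + V t * (a * V t) = 0"
    using assms(3,4) unfolding geodesic_def covariant_derivative_def V_def by auto
  then have "G 2 t = - a * (V t)\<^sup>2"
    using vector_derivative_within[OF at_within_time_interval_neq_bot[OF assms(4)] VG]
    by (simp add: power2_eq_square add_eq_0_iff2 mult.left_commute)
  then show thesis
    using that[of \<epsilon> "G 0"] G V VG \<open>\<epsilon> > 0\<close> by auto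
qed

text \<open>A local lift and \<open>c\<close> have the same derivative, so locally they differ by a
  constant \<open>k\<close>, and the two curves on the torus agree exactly if \<open>k\<close> is a
  lattice point. The truth value of agreement is thus locally constant, and connectedness carries it
  from 0 to \<open>t\<close>.\<close>

lemma torus_curve_lift:
  assumes "0 < T"
    and local: "\<And>t. t \<in> time_interval T \<Longrightarrow> \<exists>g \<epsilon>. \<epsilon> > 0 \<and>
       (\<forall>s \<in> time_interval T \<inter> ball t \<epsilon>. \<sigma> s = torus_proj lam (g s) \<and>
         (g has_vector_derivative V s) (at s within time_interval T))"
    and c: "\<And>t. t \<in> time_interval T \<Longrightarrow> (c has_vector_derivative V t) (at t within time_interval T)"
    and "\<sigma> 0 = torus_proj lam (c 0)"
    and "t \<in> time_interval T"
  shows "\<sigma> t = torus_proj lam (c t)"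
proof -
  have "(\<sigma> 0 = torus_proj lam (c 0)) = (\<sigma> t = torus_proj lam (c t))"
  proof (rule connected_local_const[of "time_interval T"])
    show "connected (time_interval T)"
      by (rule convex_connected[OF convex_time_interval])
    show "\<forall>t\<in>time_interval T. \<forall>\<^sub>F s in at t within time_interval T.
        (\<sigma> t = torus_proj lam (c t)) = (\<sigma> s = torus_proj lam (c s))"
    proof
      fix t assume t: "t \<in> time_interval T"
      obtain g \<epsilon> where "\<epsilon> > 0" and g: "\<And>s. s \<in> time_interval T \<inter> ball t \<epsilon> \<Longrightarrow> \<sigma> s = torus_proj lam (g s)"
        "\<And>s. s \<in> time_interval T \<inter> ball t \<epsilon> \<Longrightarrow> (g has_vector_derivative V s) (at s within time_interval T)"
        using local[OF t] by blast
      let ?J = "time_interval T \<inter> ball t \<epsilon>"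
      have "\<exists>k. \<forall>s\<in>?J. g s - c s = k"
      proof (rule has_derivative_zero_constant)
        show "convex ?J"
          by (intro convex_Int convex_time_interval convex_ball)
        fix s assume s: "s \<in> ?J"
        have "((\<lambda>s. g s - c s) has_vector_derivative V s - V s) (at s within time_interval T)"
          using s by (intro has_vector_derivative_diff g c) auto
        then have "((\<lambda>s. g s - c s) has_vector_derivative 0) (at s within ?J)"
          by (auto intro: has_vector_derivative_within_subset)
        then show "((\<lambda>s. g s - c s) has_derivative (\<lambda>h. 0)) (at s within ?J)"
          by (simp add: has_vector_derivative_def)
      qed
      then obtain k where k: "\<And>s. s \<in> ?J \<Longrightarrow> g s - c s = k"
        by blast
      have *: "(\<sigma> s = torus_proj lam (c s)) \<longleftrightarrow> k \<in> lattice lam" if "s \<in> ?J" for s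
        using g(1)[OF that] k[OF that] by (simp add: torus_proj_eq_iff)
      have "t \<in> ?J"
        using t \<open>\<epsilon> > 0\<close> by simp
      show "\<forall>\<^sub>F s in at t within time_interval T.
          (\<sigma> t = torus_proj lam (c t)) = (\<sigma> s = torus_proj lam (c s))"
        unfolding eventually_at
        by (intro exI[of _ \<epsilon>]) (use \<open>\<epsilon> > 0\<close> *[OF \<open>t \<in> ?J\<close>] * in \<open>auto simp: dist_commute\<close>)
    qed
  qed (use assms zero_in_time_interval in auto)
  with assms show ?thesis
    by simp
qed

section \<open>Solving the Riccati equation\<close>

lemma time_interval_antiderivative:
  fixes V :: "real \<Rightarrow> complex"
  assumes "continuous_on (time_interval T) V"
  obtains F where "F 0 = 0"
    "\<And>t. t \<in> time_interval T \<Longrightarrow> (F has_vector_derivative V t) (at t within time_interval T)"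
proof -
  let ?F = "\<lambda>t. integral {0..t} V"
  have "(?F has_vector_derivative V t) (at t within time_interval T)" if "t \<in> time_interval T" for t
  proof -
    have "0 \<le> t" "ereal t < T"
    using that by (auto simp: time_interval_def)
  then obtain s where s: "ereal t < ereal s" "ereal s < T"
    using ereal_dense2 by blast
  then have sub: "{0..s} \<subseteq> time_interval T"
    using \<open>0 \<le> t\<close> by (intro time_interval_Icc) (auto simp: time_interval_def)
  have "(?F has_vector_derivative V t) (at t within {0..s})"
    using s \<open>0 \<le> t\<close> continuous_on_subset[OF assms sub]
    by (intro integral_has_vector_derivative) auto
  \<comment> \<open>Since \<open>s > t\<close>, both sets agree near \<open>t\<close>; this
    transfers the fundamental theorem of calculus from the compact interval.\<close>
  moreover have "at t within time_interval T = at t within {0..s}"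
    by (rule at_within_nhd[of t "{..<s}"]) (use s sub in \<open>auto simp: time_interval_def\<close>)
  ultimately show ?thesis
    by simp
  qed
  then show thesis
    using that[of ?F] by simp
qed

text \<open>
  With \<open>F\<close> a primitive of \<open>V\<close>, the integrating factor \<open>exp (a F)\<close> shows that
  \<open>V t (1 + a V 0 t) - V 0\<close>, which vanishes at \<open>0\<close>, vanishes identically.
\<close>

lemma riccati_solution:
  fixes V :: "real \<Rightarrow> complex"
  assumes "0 < T"
    and V: "\<And>t. t \<in> time_interval T \<Longrightarrow>
      (V has_vector_derivative - a * (V t)\<^sup>2) (at t within time_interval T)"
    and "t \<in> time_interval T"
  shows "V t * (1 + a * V 0 * of_real t) = V 0"
proof -
  have "continuous_on (time_interval T) V"
    using V has_vector_derivative_continuous continuous_on_eq_continuous_within by blast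
  then obtain F where F: "F 0 = 0"
    "\<And>t. t \<in> time_interval T \<Longrightarrow> (F has_vector_derivative V t) (at t within time_interval T)"
    using time_interval_antiderivative by blast
  define D where "D t = (V t * (1 + a * V 0 * of_real t) - V 0) * exp (a * F t)" for t
  have "\<exists>k. \<forall>t\<in>time_interval T. D t = k"
  proof (rule has_derivative_zero_constant[OF convex_time_interval])
    fix s assume s: "s \<in> time_interval T"
    have "((\<lambda>t. exp (a * F t)) has_vector_derivative (a * V s * exp (a * F s))) (at s within time_interval T)"
      using field_vector_diff_chain_within[of "\<lambda>t. a * F t" "a * V s" s "time_interval T" exp "exp (a * F s)"]
        has_vector_derivative_mult_right[OF F(2)[OF s], of a]
      by (auto simp: o_def DERIV_exp has_field_derivative_at_within)
    moreover have "((\<lambda>t. of_real t :: complex) has_vector_derivative 1) (at s within time_interval T)"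
      using has_vector_derivative_of_real[OF DERIV_ident] by simp
    ultimately have "(D has_vector_derivative
        (V s * (1 + a * V 0 * of_real s) - V 0) * (a * V s * exp (a * F s)) +
        ((V s * (0 + a * V 0 * 1) + - a * (V s)\<^sup>2 * (1 + a * V 0 * of_real s)) - 0) * exp (a * F s))
        (at s within time_interval T)"
      unfolding D_def
      by (intro has_vector_derivative_mult has_vector_derivative_diff has_vector_derivative_add
          has_vector_derivative_mult_right has_vector_derivative_const V[OF s])
    moreover have "(V s * (1 + a * V 0 * of_real s) - V 0) * (a * V s * exp (a * F s)) +
        ((V s * (0 + a * V 0 * 1) + - a * (V s)\<^sup>2 * (1 + a * V 0 * of_real s)) - 0) * exp (a * F s) = 0"
      by (simp add: power2_eq_square algebra_simps)
    ultimately show "(D has_derivative (\<lambda>h. 0)) (at s within time_interval T)"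
      by (simp add: has_vector_derivative_def)
  qed
  then have "D t = D 0"
    using assms zero_in_time_interval by metis
  then show ?thesis
    by (simp add: D_def)
qed

section \<open>Maximal geodesics\<close>

text \<open>The displacement of the lifted geodesic with initial velocity \<open>v\<close>. The
  argument is complex so that derivatives of all orders come from holomorphy.\<close>

definition geodesic_lift :: "complex \<Rightarrow> complex \<Rightarrow> complex \<Rightarrow> complex" where
  "geodesic_lift a v z = (if a = 0 then v * z else Ln (1 + a * v * z) / a)"

lemma geodesic_lift_0 [simp]: "geodesic_lift a v 0 = 0"
  by (simp add: geodesic_lift_def)

lemma DERIV_geodesic_lift:
  assumes "1 + a * v * z \<notin> \<real>\<^sub>\<le>\<^sub>0"
  shows "(geodesic_lift a v has_field_derivative v / (1 + a * v * z)) (at z)"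
proof (cases "a = 0")
  case True
  then show ?thesis
    unfolding geodesic_lift_def by (auto intro!: derivative_eq_intros)
next
  case False
  then show ?thesis
    unfolding geodesic_lift_def using assms
    by (auto intro!: derivative_eq_intros simp: divide_simps)
qed

text \<open>The explicit curves are geodesics as long as the logarithm stays off its branch cut.
  They serve both as extensions that contradict maximality and as the closed geodesic in the limit
  set.\<close>

lemma geodesic_geodesic_lift:
  assumes "Im lam > 0" "represented_by lam nabla a" "0 < T"
    and dom: "\<And>t. t \<in> time_interval T \<Longrightarrow> 1 + a * v * of_real t \<notin> \<real>\<^sub>\<le>\<^sub>0"
    and \<sigma>: "\<And>t. t \<in> time_interval T \<Longrightarrow> \<sigma> t = torus_proj lam (z0 + geodesic_lift a v (of_real t))"
  shows "geodesic lam nabla T \<sigma>"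
    and "\<And>t. t \<in> time_interval T \<Longrightarrow> velocity lam T \<sigma> t = v / (1 + a * v * of_real t)"
proof -
  define f where "f z = z0 + geodesic_lift a v z" for z
  define S where "S = {z. 1 + a * v * z \<notin> \<real>\<^sub>\<le>\<^sub>0}"
  have df: "(f has_field_derivative v / (1 + a * v * z)) (at z)" if "z \<in> S" for z
    unfolding f_def using DERIV_geodesic_lift[of a v z] that
    by (auto simp: S_def intro!: derivative_eq_intros)
  have "S = (\<lambda>z. 1 + a * v * z) -` (- \<real>\<^sub>\<le>\<^sub>0)"
    by (auto simp: S_def)
  moreover have "open \<dots>"
    by (intro continuous_open_vimage continuous_intros open_Compl) auto
  ultimately have "open S"
    by simp
  have hol: "f holomorphic_on S"
    using df \<open>open S\<close> by (auto simp: holomorphic_on_open)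
  have fv: "((\<lambda>t. f (of_real t)) has_vector_derivative v / (1 + a * v * of_real t)) (at t within time_interval T)"
    if "t \<in> time_interval T" for t
    using df[of "of_real t"] dom[OF that] by (intro has_vector_derivative_real_field) (auto simp: S_def)
  show vel: "velocity lam T \<sigma> t = v / (1 + a * v * of_real t)" if "t \<in> time_interval T" for t
    using fv[OF that] \<sigma> assms(1) that
    by (intro velocity_eq) (auto simp: has_velocity_def f_def intro!: exI[of _ "\<lambda>t. f (of_real t)"] exI[of _ 1])
  define G where "G k s = (deriv ^^ k) f (complex_of_real s)" for k s
  have "\<sigma> s = torus_proj lam (G 0 s) \<and>
      (\<forall>k. (G k has_vector_derivative G (Suc k) s) (at s within time_interval T))"
    if s: "s \<in> time_interval T" for s
  proof (intro conjI allI)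
    show "\<sigma> s = torus_proj lam (G 0 s)"
      using \<sigma>[OF s] by (simp add: G_def f_def)
    fix k
    have "of_real s \<in> S"
      using dom[OF s] by (simp add: S_def)
    have "((deriv ^^ k) f has_field_derivative deriv ((deriv ^^ k) f) (of_real s)) (at (of_real s))"
      by (rule holomorphic_derivI[OF holomorphic_higher_deriv[OF hol \<open>open S\<close>] \<open>open S\<close> \<open>of_real s \<in> S\<close>])
    then show "(G k has_vector_derivative G (Suc k) s) (at s within time_interval T)"
      unfolding G_def by (auto intro: has_vector_derivative_real_field)
  qed
  then have smooth: "smooth_curve lam T \<sigma>"
    unfolding smooth_curve_def by (intro ballI exI[of _ G] exI[of _ 1]) auto
  have "covariant_derivative lam nabla T \<sigma> (velocity lam T \<sigma>) t = 0" if t: "t \<in> time_interval T" for t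
  proof -
    let ?w = "1 + a * v * of_real t"
    have "?w \<noteq> 0"
      using dom[OF t] by force
    \<comment> \<open>This derivative is \<open>- a\<close> times the square of the velocity, which
      cancels the connection term.\<close>
    have "((\<lambda>z. v / (1 + a * v * z)) has_field_derivative - (a * v * v) / ?w\<^sup>2) (at (of_real t))"
      using \<open>?w \<noteq> 0\<close> by (auto intro!: derivative_eq_intros simp: power2_eq_square)
    then have "((\<lambda>s. v / (1 + a * v * of_real s)) has_vector_derivative - (a * v * v) / ?w\<^sup>2)
        (at t within time_interval T)"
      by (rule has_vector_derivative_real_field)
    then have "(velocity lam T \<sigma> has_vector_derivative - (a * v * v) / ?w\<^sup>2) (at t within time_interval T)"
      by (rule has_vector_derivative_transform[OF t vel, rotated])
    then have "vector_derivative (velocity lam T \<sigma>) (at t within time_interval T) = - (a * v * v) / ?w\<^sup>2"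
      by (rule vector_derivative_within[OF at_within_time_interval_neq_bot[OF t]])
    moreover have "nabla (torus lam) (\<lambda>_. 1) (\<sigma> t) = a"
      using \<sigma>[OF t] nabla_constant_section[OF assms(2)] by simp
    ultimately show ?thesis
      using \<open>?w \<noteq> 0\<close> by (simp add: covariant_derivative_def vel[OF t] power2_eq_square)
  qed
  with smooth assms(3) show "geodesic lam nabla T \<sigma>"
    by (simp add: geodesic_def)
qed

text \<open>If \<open>1 + c * t = q \<le> 0\<close>, then \<open>t > 0\<close> and \<open>c\<close>
  is the negative real \<open>p = (q - 1) / t\<close>, with \<open>p * t \<le> -1\<close>. So the
  cut can be reached only at or after the time \<open>- 1 / p\<close>.\<close>

lemma one_plus_notin_nonpos_Reals:
  fixes c :: complex
  assumes "0 \<le> t" and neg: "\<And>p. p < 0 \<Longrightarrow> c = of_real p \<Longrightarrow> t < - 1 / p"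
  shows "1 + c * of_real t \<notin> \<real>\<^sub>\<le>\<^sub>0"
proof
  assume "1 + c * of_real t \<in> \<real>\<^sub>\<le>\<^sub>0"
  then obtain q where q: "1 + c * of_real t = of_real q" "q \<le> 0"
    by (auto elim!: nonpos_Reals_cases)
  have "t \<noteq> 0"
  proof
    assume "t = 0"
    then have "complex_of_real q = 1"
      using q(1) by simp
    then show False
      using q(2) by simp
  qed
  then have "t > 0"
    using assms by simp
  define p where "p = (q - 1) / t"
  have pt: "p * t = q - 1"
    using \<open>t \<noteq> 0\<close> by (simp add: p_def)
  have "c * of_real t = of_real (q - 1)"
    using q(1) by (simp add: eq_diff_eq add.commute)
  then have "c * of_real t = of_real p * of_real t"
    by (simp only: pt[symmetric] of_real_mult)
  then have "c = of_real p"
    using \<open>t \<noteq> 0\<close> by simp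
  moreover have "p < 0"
    using q \<open>t > 0\<close> by (simp add: p_def divide_neg_pos)
  ultimately have "-1 < t * p"
    using neg[of p] neg_less_divide_eq[of p t "-1"] by blast
  with pt q(2) show False
    by (simp add: mult.commute)
qed

text \<open>The Riccati solution determines the velocity, hence the lift. A zero of
  \<open>1 + a * v * t\<close> bounds \<open>T\<close> from above, and the explicit curves show that
  a maximal geodesic cannot stop earlier.\<close>

lemma maximal_geodesic_form:
  assumes "Im lam > 0" "represented_by lam nabla a" "maximal_geodesic lam nabla T \<sigma>"
    and "\<not> \<sigma> constant_on time_interval T"
  obtains v z0 where "v \<noteq> 0" "0 < T" "velocity lam T \<sigma> 0 = v"
    "\<And>t. t \<in> time_interval T \<Longrightarrow> 1 + a * v * of_real t \<notin> \<real>\<^sub>\<le>\<^sub>0"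
    "\<And>t. t \<in> time_interval T \<Longrightarrow> \<sigma> t = torus_proj lam (z0 + geodesic_lift a v (of_real t))"
    "\<And>t. t \<in> time_interval T \<Longrightarrow> velocity lam T \<sigma> t = v / (1 + a * v * of_real t)"
    "\<And>p. p < 0 \<Longrightarrow> a * v = of_real p \<Longrightarrow> T = ereal (- 1 / p)"
    "(\<And>p. p < 0 \<Longrightarrow> a * v \<noteq> of_real p) \<Longrightarrow> T = \<infinity>"
proof -
  define V where "V = velocity lam T \<sigma>"
  define v where "v = V 0"
  have geo: "geodesic lam nabla T \<sigma>"
    using assms by (simp add: maximal_geodesic_def)
  then have "0 < T" "smooth_curve lam T \<sigma>"
    by (auto simp: geodesic_def)
  then obtain z0 where z0: "\<sigma> 0 = torus_proj lam z0"
    using smooth_curve_in_torus zero_in_time_interval by blast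
  have local: "\<exists>g \<epsilon>. \<epsilon> > 0 \<and>
       (\<forall>s \<in> time_interval T \<inter> ball t \<epsilon>. \<sigma> s = torus_proj lam (g s) \<and>
         (g has_vector_derivative V s) (at s within time_interval T))" if "t \<in> time_interval T" for t
    using geodesic_ode[OF assms(1,2) geo that] unfolding V_def by metis
  have "(V has_vector_derivative - a * (V t)\<^sup>2) (at t within time_interval T)"
    if "t \<in> time_interval T" for t
    using geodesic_ode[OF assms(1,2) geo that] unfolding V_def by metis
  from riccati_solution[OF \<open>0 < T\<close> this]
  have Vt: "V t * (1 + a * v * of_real t) = v" if "t \<in> time_interval T" for t
    using that by (simp add: v_def)
  have "v \<noteq> 0"
  proof
    assume "v = 0"
    then have "V t = 0" if "t \<in> time_interval T" for t
      using Vt[OF that] by simp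
    then have "\<sigma> t = torus_proj lam z0" if "t \<in> time_interval T" for t
      using torus_curve_lift[OF \<open>0 < T\<close> local, of "\<lambda>_. z0" t] z0 that
      by (simp add: has_vector_derivative_const)
    with assms(4) show False
      unfolding constant_on_def by blast
  qed
  have nz: "1 + a * v * of_real t \<noteq> 0" if "t \<in> time_interval T" for t
    using Vt[OF that] \<open>v \<noteq> 0\<close> by auto
  \<comment> \<open>At time \<open>- 1 / p\<close> the factor in \<open>Vt\<close> would vanish
    although the product is \<open>v \<noteq> 0\<close>.\<close>
  have T_le: "T \<le> ereal (- 1 / p)" if p: "p < 0" "a * v = of_real p" for p
  proof (rule ccontr)
    assume "\<not> T \<le> ereal (- 1 / p)"
    then have "- 1 / p \<in> time_interval T"
      using p by (simp add: time_interval_def divide_nonneg_neg not_le)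
    moreover have "1 + a * v * of_real (- 1 / p) = 0"
      using p by simp
    ultimately show False
      using nz by blast
  qed
  have dom: "1 + a * v * of_real t \<notin> \<real>\<^sub>\<le>\<^sub>0" if "t \<in> time_interval T" for t
  proof (rule one_plus_notin_nonpos_Reals)
    show "0 \<le> t"
      using that by (simp add: time_interval_def)
    show "t < - 1 / p" if "p < 0" "a * v = of_real p" for p
      using T_le[OF that] \<open>t \<in> time_interval T\<close> order.strict_trans2[of "ereal t" T "ereal (- 1 / p)"]
      by (simp add: time_interval_def)
  qed
  have \<sigma>: "\<sigma> t = torus_proj lam (z0 + geodesic_lift a v (of_real t))" if "t \<in> time_interval T" for t
  proof (rule torus_curve_lift[OF \<open>0 < T\<close> local _ _ that])
    fix s assume s: "s \<in> time_interval T"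
    have "((\<lambda>s. geodesic_lift a v (of_real s)) has_vector_derivative v / (1 + a * v * of_real s))
        (at s within time_interval T)"
      by (intro has_vector_derivative_real_field DERIV_geodesic_lift dom s)
    moreover have "v / (1 + a * v * of_real s) = V s"
      using nz[OF s] Vt[OF s] by (simp add: divide_eq_eq)
    ultimately show "((\<lambda>s. z0 + geodesic_lift a v (of_real s)) has_vector_derivative V s)
        (at s within time_interval T)"
      using has_vector_derivative_add[OF has_vector_derivative_const] by fastforce
  qed (auto simp: z0)
  \<comment> \<open>On any longer interval avoiding the cut the explicit formula would extend the
    geodesic.\<close>
  have no_extension: "\<not> T < T'"
    if "\<And>t. t \<in> time_interval T' \<Longrightarrow> 1 + a * v * of_real t \<notin> \<real>\<^sub>\<le>\<^sub>0" for T'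
  proof
    assume "T < T'"
    have "geodesic lam nabla T' (\<lambda>t. torus_proj lam (z0 + geodesic_lift a v (of_real t)))"
      using \<open>T < T'\<close> \<open>0 < T\<close> that by (intro geodesic_geodesic_lift[OF assms(1,2)]) auto
    with \<open>T < T'\<close> \<sigma> show False
      using assms(3) unfolding maximal_geodesic_def by auto
  qed
  show thesis
  proof (rule that[of v z0])
    show "velocity lam T \<sigma> 0 = v"
      by (simp add: v_def V_def)
    show "velocity lam T \<sigma> t = v / (1 + a * v * of_real t)" if "t \<in> time_interval T" for t
      by (rule geodesic_geodesic_lift(2)[OF assms(1,2) \<open>0 < T\<close> dom \<sigma> that])
    show "T = ereal (- 1 / p)" if p: "p < 0" "a * v = of_real p" for p
    proof -
      have "\<not> T < ereal (- 1 / p)"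
      proof (intro no_extension one_plus_notin_nonpos_Reals)
        fix t p' :: real
        assume t: "t \<in> time_interval (ereal (- 1 / p))"
        then show "0 \<le> t"
          by (simp add: time_interval_def)
        assume "a * v = of_real p'"
        then have "p' = p"
          using p(2) of_real_eq_iff by metis
        then show "t < - 1 / p'"
          using t by (simp add: time_interval_def)
      qed
      then show ?thesis
        using T_le[OF p] by simp
    qed
    show "T = \<infinity>" if "\<And>p. p < 0 \<Longrightarrow> a * v \<noteq> of_real p"
    proof -
      have "\<not> T < \<infinity>"
        using that by (intro no_extension one_plus_notin_nonpos_Reals) (auto simp: time_interval_def)
      then show ?thesis
        by simp
    qed
  qed (use \<open>v \<noteq> 0\<close> \<open>0 < T\<close> dom \<sigma> in auto)
qed

section \<open>Limit sets of geodesics\<close>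

lemma range_line_scale:
  assumes "c \<noteq> 0"
  shows "range (line (of_real c * u) b) = range (line u b)"
proof
  show "range (line (of_real c * u) b) \<subseteq> range (line u b)"
  proof clarify
    fix t show "line (of_real c * u) b t \<in> range (line u b)"
      by (rule range_eqI[of _ _ "c * t"]) (simp add: line_def)
  qed
  show "range (line u b) \<subseteq> range (line (of_real c * u) b)"
  proof clarify
    fix t show "line u b t \<in> range (line (of_real c * u) b)"
      by (rule range_eqI[of _ _ "t / c"]) (use assms in \<open>simp add: line_def\<close>)
  qed
qed

lemma real_multiples_latticeD:
  assumes "u \<in> real_multiples (- {0}) (lattice lam)"
  obtains k where "k > 0" "u * of_real k \<in> lattice lam"
proof -
  obtain r x where r: "r \<noteq> 0" "x \<in> lattice lam" "u = of_real r * x"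
    using assms unfolding real_multiples_def by auto
  \<comment> \<open>The result is \<open>x\<close> or \<open>- x\<close>; symmetry of the lattice
    allows a positive period for either sign of \<open>r\<close>.\<close>
  have "u * of_real (1 / \<bar>r\<bar>) \<in> lattice lam"
    using r lattice_uminus by (cases "r > 0") auto
  with r(1) show thesis
    using that[of "1 / \<bar>r\<bar>"] by simp
qed

text \<open>Here the lift is \<open>ln (1 + p * t) / a\<close>, which moves along the direction
  \<open>cnj a\<close>. The logarithm tends to plus or minus infinity according to the sign of
  \<open>p\<close>; the factor \<open>s = sgn p\<close> makes \<open>r\<close> diverge upwards in
  both cases.\<close>

lemma geodesic_lift_real_param:
  assumes "a \<noteq> 0" "p \<noteq> 0" "a * v = of_real p"
    and T: "T = (if p < 0 then ereal (- 1 / p) else \<infinity>)"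
  obtains s :: real and r where "s \<in> {1, -1}" "continuous_on (time_interval T) r"
    "filterlim r at_top (time_end T)" "r 0 = 0"
    "\<And>t. t \<in> time_interval T \<Longrightarrow> geodesic_lift a v (of_real t) = of_real s * cnj a * of_real (r t)"
proof
  define N where "N = (cmod a)\<^sup>2"
  have "N > 0"
    using assms by (simp add: N_def)
  define r where "r t = sgn p * (ln (1 + p * t) / N)" for t
  have pos: "1 + p * t > 0" if "t \<in> time_interval T" for t
  proof (cases "p < 0")
    case True
    then have "t < - 1 / p"
      using that T by (simp add: time_interval_def)
    then have "-1 < t * p"
      using neg_less_divide_eq[OF True, of t "-1"] by blast
    then show ?thesis
      by (simp add: mult.commute)
  next
    case False
    then show ?thesis
      using that by (simp add: time_interval_def add_pos_nonneg)
  qed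
  show "sgn p \<in> {1, -1}"
    using assms(2) by (auto simp: sgn_if)
  show "continuous_on (time_interval T) r"
    unfolding r_def by (intro continuous_intros) (use pos \<open>N > 0\<close> in force)+
  show "r 0 = 0"
    by (simp add: r_def)
  show "filterlim r at_top (time_end T)"
  proof (cases "p < 0")
    case True
    have "((\<lambda>t. 1 + p * t) \<longlongrightarrow> 1 + p * (- 1 / p)) (at_left (- 1 / p))"
      by (intro tendsto_intros)
    moreover have "\<forall>\<^sub>F t in at_left (- 1 / p). 1 + p * t > 0"
      unfolding eventually_at_filter
    proof (intro always_eventually allI impI)
      fix t assume "t \<in> {..< - 1 / p}"
      then have "-1 < t * p"
        using neg_less_divide_eq[OF True, of t "-1"] by simp
      then show "1 + p * t > 0"
        by (simp add: mult.commute)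
    qed
    \<comment> \<open>The geodesic reaches infinite length in the plane as the argument of the
      logarithm decreases to 0 in finite time.\<close>
    ultimately have "filterlim (\<lambda>t. 1 + p * t) (at_right 0) (at_left (- 1 / p))"
      using True by (intro filterlim_at_withinI) (auto simp: eventually_mono)
    then have "filterlim (\<lambda>t. ln (1 + p * t)) at_bot (at_left (- 1 / p))"
      by (rule filterlim_compose[OF ln_at_0])
    then have "filterlim (\<lambda>t. - ln (1 + p * t)) at_top (at_left (- 1 / p))"
      by (simp add: filterlim_uminus_at_top)
    then have "filterlim (\<lambda>t. inverse N * (- ln (1 + p * t))) at_top (at_left (- 1 / p))"
      using \<open>N > 0\<close> by (intro filterlim_tendsto_pos_mult_at_top[OF tendsto_const]) auto
    moreover have "inverse N * (- ln (1 + p * t)) = r t" for t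
      using True by (simp add: r_def field_simps)
    ultimately show ?thesis
      using True T by (simp add: time_end_ereal)
  next
    case False
    then have "p > 0"
      using assms(2) by simp
    have "filterlim (\<lambda>t. 1 + p * t) at_top at_top"
      by (intro filterlim_tendsto_add_at_top[OF tendsto_const]
          filterlim_tendsto_pos_mult_at_top[OF tendsto_const \<open>p > 0\<close>] filterlim_ident)
    then have "filterlim (\<lambda>t. ln (1 + p * t)) at_top at_top"
      by (rule filterlim_compose[OF ln_at_top])
    then have "filterlim (\<lambda>t. inverse N * ln (1 + p * t)) at_top at_top"
      using \<open>N > 0\<close> by (intro filterlim_tendsto_pos_mult_at_top[OF tendsto_const]) auto
    moreover have "inverse N * ln (1 + p * t) = r t" for t
      using \<open>p > 0\<close> by (simp add: r_def field_simps)
    ultimately show ?thesis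
      using \<open>p > 0\<close> T by (simp add: time_end_PInf)
  qed
  fix t assume t: "t \<in> time_interval T"
  have "1 + a * v * of_real t = of_real (1 + p * t)"
    by (simp add: assms)
  then have "geodesic_lift a v (of_real t) = of_real (ln (1 + p * t)) / a"
    using pos[OF t] assms(1) by (simp only: geodesic_lift_def if_False Ln_of_real)
  \<comment> \<open>Turns the direction \<open>1 / a\<close> of the lift into the direction
    \<open>cnj a\<close> of the line.\<close>
  also have "1 / a = cnj a / of_real N"
    using assms(1) unfolding N_def complex_norm_square by simp
  then have "of_real (ln (1 + p * t)) / a = of_real (ln (1 + p * t)) * (cnj a / of_real N)"
    by (metis mult.right_neutral times_divide_eq_right)
  also have "\<dots> = of_real (sgn p * sgn p) * cnj a * of_real (ln (1 + p * t) / N)"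
    using assms(2) by (simp add: sgn_if)
  also have "\<dots> = of_real (sgn p) * cnj a * of_real (r t)"
    by (simp only: r_def of_real_mult mult_ac)
  finally show "geodesic_lift a v (of_real t) = of_real (sgn p) * cnj a * of_real (r t)" .
qed

lemma omega_limit_real_geodesic:
  assumes "Im lam > 0" "0 < T" "a \<noteq> 0" "p \<noteq> 0" "a * v = of_real p"
    and "T = (if p < 0 then ereal (- 1 / p) else \<infinity>)"
    and \<sigma>: "\<And>t. t \<in> time_interval T \<Longrightarrow> \<sigma> t = torus_proj lam (z0 + geodesic_lift a v (of_real t))"
  shows "omega_limit lam T \<sigma> =
    torus_topology lam closure_of (torus_proj lam ` range (line (cnj a) z0))"
proof -
  obtain s r where s: "s \<in> {1, -1}" and r: "continuous_on (time_interval T) r"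
    "filterlim r at_top (time_end T)"
    "\<And>t. t \<in> time_interval T \<Longrightarrow> geodesic_lift a v (of_real t) = of_real s * cnj a * of_real (r t)"
    using geodesic_lift_real_param[OF assms(3-6)] by metis
  have "omega_limit lam T \<sigma> =
    torus_topology lam closure_of (torus_proj lam ` range (line (of_real s * cnj a) z0))"
    by (rule omega_limit_asymptotic_line[OF assms(1,2) _ r(1,2) tendsto_const])
      (simp add: \<sigma> r(3) add.commute)
  moreover have "s \<noteq> 0"
    using s by auto
  ultimately show ?thesis
    by (simp add: range_line_scale)
qed

text \<open>The parameter \<open>r\<close> starts at 0 and takes every nonnegative value, so the
  curve covers a full period and hence the whole projected line. The velocity keeps its direction
  but never regains its initial value, since \<open>a * v\<close> is nonzero.\<close>

lemma closed_real_geodesic: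
  assumes "Im lam > 0" "0 < T" "a \<noteq> 0" "p \<noteq> 0" "a * v = of_real p"
    and T: "T = (if p < 0 then ereal (- 1 / p) else \<infinity>)"
    and dom: "\<And>t. t \<in> time_interval T \<Longrightarrow> 1 + a * v * of_real t \<notin> \<real>\<^sub>\<le>\<^sub>0"
    and \<sigma>: "\<And>t. t \<in> time_interval T \<Longrightarrow> \<sigma> t = torus_proj lam (z0 + geodesic_lift a v (of_real t))"
    and vel: "\<And>t. t \<in> time_interval T \<Longrightarrow> velocity lam T \<sigma> t = v / (1 + a * v * of_real t)"
    and k: "k > 0" "cnj a * of_real k \<in> lattice lam"
  shows "closed_curve lam T \<sigma>" "\<not> periodic_curve lam T \<sigma>"
    "support T \<sigma> = torus_proj lam ` range (line (cnj a) z0)"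
proof -
  have "v \<noteq> 0"
    using assms by auto
  have zero: "0 \<in> time_interval T"
    by (rule zero_in_time_interval[OF assms(2)])
  have vel0: "velocity lam T \<sigma> 0 = v"
    using vel[OF zero] by simp
  obtain s r where s: "s \<in> {1, -1}" and r: "continuous_on (time_interval T) r"
    "filterlim r at_top (time_end T)" "r 0 = 0"
    "\<And>t. t \<in> time_interval T \<Longrightarrow> geodesic_lift a v (of_real t) = of_real s * cnj a * of_real (r t)"
    using geodesic_lift_real_param[OF assms(3-6)] by metis
  define u where "u = of_real s * cnj a"
  have u: "u * of_real k \<in> lattice lam"
    using s k lattice_uminus[OF k(2)] by (auto simp: u_def)
  have \<sigma>_line: "\<sigma> t = torus_proj lam (line u z0 (r t))" if "t \<in> time_interval T" for t
    using \<sigma>[OF that] r(4)[OF that] by (simp add: u_def line_def add.commute)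
  have attain: "\<exists>t\<in>time_interval T. r t = \<rho>" if "0 \<le> \<rho>" for \<rho>
    using time_end_intermediate_value[OF assms(2) zero r(1,2), of \<rho>] that r(3) by auto
  have "range (line u z0) = range (line (cnj a) z0)"
    unfolding u_def using s by (intro range_line_scale) auto
  moreover have "torus_proj lam ` range (line u z0) \<subseteq> support T \<sigma>"
    unfolding torus_line_periodic[OF k(1) u, symmetric] support_def
  proof clarify
    fix \<rho> assume "\<rho> \<in> {0..k}"
    then obtain t where "t \<in> time_interval T" "r t = \<rho>"
      using attain by auto
    then show "torus_proj lam (line u z0 \<rho>) \<in> \<sigma> ` time_interval T"
      using \<sigma>_line by (intro image_eqI[of _ _ t]) auto
  qed
  moreover have "support T \<sigma> \<subseteq> torus_proj lam ` range (line u z0)"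
    unfolding support_def using \<sigma>_line by auto
  ultimately show "support T \<sigma> = torus_proj lam ` range (line (cnj a) z0)"
    by simp
  \<comment> \<open>A time at which one full period has been travelled.\<close>
  obtain l where l: "l \<in> time_interval T" "r l = k"
    using attain[of k] k(1) by auto
  then have "l > 0"
    using k(1) r(3) by (cases "l = 0") (auto simp: time_interval_def)
  have "\<sigma> l = \<sigma> 0"
    using \<sigma>_line[OF l(1)] \<sigma>_line[OF zero] u by (simp add: l(2) r(3) line_def torus_proj_eq_iff)
  have eq: "1 + a * v * of_real t = of_real (1 + p * t)" for t
    by (simp add: assms(5))
  have "1 + p * l > 0"
    using dom[OF l(1)] unfolding eq nonpos_Reals_of_real_iff by simp
  show "closed_curve lam T \<sigma>"
    unfolding closed_curve_def
  proof (intro bexI[of _ l] conjI exI[of _ "1 / (1 + p * l)"])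
    show "velocity lam T \<sigma> l = of_real (1 / (1 + p * l)) * velocity lam T \<sigma> 0"
      by (simp add: vel[OF l(1)] vel0 eq del: of_real_add)
  qed (use l \<open>l > 0\<close> \<open>\<sigma> l = \<sigma> 0\<close> \<open>1 + p * l > 0\<close> in auto)
  show "\<not> periodic_curve lam T \<sigma>"
  proof
    assume "periodic_curve lam T \<sigma>"
    then obtain t where t: "t \<in> time_interval T" "t > 0" "velocity lam T \<sigma> t = velocity lam T \<sigma> 0"
      unfolding periodic_curve_def by blast
    have "1 + a * v * of_real t \<noteq> 0"
      using dom[OF t(1)] by force
    then have "v = v * (1 + a * v * of_real t)"
      using t(3) vel[OF t(1)] vel0 by (simp add: divide_eq_eq)
    then show False
      using \<open>v \<noteq> 0\<close> assms(3) t(2) by (simp add: algebra_simps)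
  qed
qed

text \<open>
  Since \<open>1 + a v t = (1 + t) q t\<close> with \<open>q t\<close> tending to \<open>a v\<close>, the lift is \<open>ln (1 + t) / a\<close> plus a
  convergent term, and \<open>1 / a\<close> is a positive multiple of \<open>cnj a\<close>.
\<close>

lemma omega_limit_complete_geodesic:
  assumes "Im lam > 0" "a \<noteq> 0" "a * v \<notin> \<real>\<^sub>\<le>\<^sub>0"
    and \<sigma>: "\<And>t. 0 \<le> t \<Longrightarrow> \<sigma> t = torus_proj lam (z0 + geodesic_lift a v (of_real t))"
    and dom: "\<And>t. 0 \<le> t \<Longrightarrow> 1 + a * v * of_real t \<notin> \<real>\<^sub>\<le>\<^sub>0"
  shows "omega_limit lam \<infinity> \<sigma> =
    torus_topology lam closure_of (torus_proj lam ` range (line (cnj a) (z0 + Ln (a * v) / a)))"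
proof -
  define N where "N = (cmod a)\<^sup>2"
  have "N > 0"
    using assms by (simp add: N_def)
  have inv_a: "1 / a = cnj a / of_real N"
    using assms(2) unfolding N_def complex_norm_square by simp
  define r where "r t = inverse N * ln (1 + t)" for t
  \<comment> \<open>This is \<open>(1 + a * v * t) / (1 + t)\<close>, written so that its limit is
    visible; \<open>1 + t\<close> is positive also at \<open>t = 0\<close>.\<close>
  define q where "q t = a * v + (1 - a * v) * of_real (inverse (1 + t))" for t :: real
  define e where "e t = z0 + Ln (q t) / a" for t
  show ?thesis
  proof (rule omega_limit_asymptotic_line[OF assms(1)])
    show "(0::ereal) < \<infinity>"
      by simp
    show "continuous_on (time_interval \<infinity>) r"
      unfolding r_def by (intro continuous_intros) (auto simp: time_interval_def)
    have "filterlim (\<lambda>t::real. 1 + t) at_top at_top"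
      by (intro filterlim_tendsto_add_at_top[OF tendsto_const] filterlim_ident)
    then have "filterlim (\<lambda>t::real. ln (1 + t)) at_top at_top"
      by (rule filterlim_compose[OF ln_at_top])
    then show "filterlim r at_top (time_end \<infinity>)"
      unfolding r_def time_end_PInf
      using \<open>N > 0\<close> by (intro filterlim_tendsto_pos_mult_at_top[OF tendsto_const]) auto
    have "((\<lambda>t::real. inverse (1 + t)) \<longlongrightarrow> 0) at_top"
      by (intro tendsto_inverse_0_at_top filterlim_tendsto_add_at_top[OF tendsto_const] filterlim_ident)
    then have "(q \<longlongrightarrow> a * v + (1 - a * v) * of_real 0) at_top"
      unfolding q_def by (intro tendsto_intros)
    then show "(e \<longlongrightarrow> z0 + Ln (a * v) / a) (time_end \<infinity>)"
      unfolding e_def time_end_PInf using assms(2,3) by (intro tendsto_intros tendsto_Ln) auto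
    fix t assume "t \<in> time_interval \<infinity>"
    then have "0 \<le> t"
      by (simp add: time_interval_def)
    have nz: "complex_of_real (1 + t) \<noteq> 0"
      using \<open>0 \<le> t\<close> by (simp only: of_real_eq_0_iff)
    have "of_real (1 + t) * q t = of_real (1 + t) * (a * v) + (1 - a * v) * (of_real (1 + t) * inverse (of_real (1 + t)))"
      unfolding q_def by (simp add: algebra_simps)
    also have "\<dots> = 1 + a * v * of_real t"
      unfolding right_inverse[OF nz] by (simp add: algebra_simps)
    finally have eq: "1 + a * v * of_real t = of_real (1 + t) * q t" ..
    then have "q t \<noteq> 0"
      using dom[OF \<open>0 \<le> t\<close>] by auto
    \<comment> \<open>A positive real factor leaves the argument unchanged, so the principal
      logarithm splits without a multiple of \<open>2 * pi * \<i>\<close>.\<close>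
    then have "Ln (1 + a * v * of_real t) = of_real (ln (1 + t)) + Ln (q t)"
      unfolding eq using Ln_times_of_real[of "1 + t" "q t"] Ln_of_real[of "1 + t"] \<open>0 \<le> t\<close>
      by (simp del: of_real_add)
    then have "geodesic_lift a v (of_real t) = of_real (ln (1 + t)) * (1 / a) + Ln (q t) / a"
      using assms(2) by (simp add: geodesic_lift_def add_divide_distrib)
    also have "\<dots> = cnj a * of_real (r t) + Ln (q t) / a"
      unfolding inv_a r_def by (simp add: divide_inverse)
    finally show "\<sigma> t = torus_proj lam (cnj a * of_real (r t) + e t)"
      using \<sigma>[OF \<open>0 \<le> t\<close>] by (simp add: e_def add.left_commute)
  qed
qed

theorem theorem7p1:
  fixes lam a :: complex
    and nabla :: "complex set set \<Rightarrow> (complex set \<Rightarrow> complex) \<Rightarrow> complex set \<Rightarrow> complex"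
    and T :: ereal and \<sigma> :: "real \<Rightarrow> complex set"
  assumes "Im lam > 0"
    and "holomorphic_connection (torus_proj lam) nabla"
    and "represented_by lam nabla a"
    and "maximal_geodesic lam nabla T \<sigma>"
    and "\<not> \<sigma> constant_on time_interval T"
  shows
    "(a \<noteq> 0 \<longrightarrow>
       (\<exists>b. omega_limit lam T \<sigma> =
              torus_topology lam closure_of (torus_proj lam ` range (line (cnj a) b)) \<and>
            (cnj a \<in> real_multiples (- {0}) (lattice lam) - {0} \<longrightarrow>
               closed_curve lam T \<sigma> \<and> \<not> periodic_curve lam T \<sigma> \<and>
               support T \<sigma> = torus_proj lam ` range (line (cnj a) b)
               \<or>
               \<not> closed_curve lam T \<sigma> \<and>
               (\<exists>T' \<tau>. geodesic lam nabla T' \<tau> \<and> closed_curve lam T' \<tau> \<and>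
                  omega_limit lam T \<sigma> = support T' \<tau> \<and>
                  support T' \<tau> = torus_proj lam ` range (line (cnj a) b))) \<and>
            (cnj a \<notin> real_multiples (- {0}) (lattice lam) - {0} \<longrightarrow>
               omega_limit lam T \<sigma> = torus lam)))
     \<and>
     (a = 0 \<longrightarrow>
       (\<exists>b. \<forall>t \<in> time_interval T.
          \<sigma> t = torus_proj lam (line (velocity lam T \<sigma> 0) b t)) \<and>
       (velocity lam T \<sigma> 0 \<in> real_multiples {0<..} (lattice lam) \<longrightarrow>
          closed_curve lam T \<sigma> \<and> periodic_curve lam T \<sigma>) \<and>
       (velocity lam T \<sigma> 0 \<notin> real_multiples {0<..} (lattice lam) \<longrightarrow>
          \<not> closed_curve lam T \<sigma> \<and> omega_limit lam T \<sigma> = torus lam))"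
proof -
  obtain v z0 where "v \<noteq> 0" "0 < T" and vel0: "velocity lam T \<sigma> 0 = v"
    and dom: "\<And>t. t \<in> time_interval T \<Longrightarrow> 1 + a * v * of_real t \<notin> \<real>\<^sub>\<le>\<^sub>0"
    and \<sigma>: "\<And>t. t \<in> time_interval T \<Longrightarrow> \<sigma> t = torus_proj lam (z0 + geodesic_lift a v (of_real t))"
    and vel: "\<And>t. t \<in> time_interval T \<Longrightarrow> velocity lam T \<sigma> t = v / (1 + a * v * of_real t)"
    and T_fin: "\<And>p. p < 0 \<Longrightarrow> a * v = of_real p \<Longrightarrow> T = ereal (- 1 / p)"
    and T_inf: "(\<And>p. p < 0 \<Longrightarrow> a * v \<noteq> of_real p) \<Longrightarrow> T = \<infinity>"
    using maximal_geodesic_form[OF assms(1,3-5)] by blast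
  have dense: "omega_limit lam T \<sigma> = torus lam"
    if "omega_limit lam T \<sigma> = torus_topology lam closure_of (torus_proj lam ` range (line u b))"
      "u \<noteq> 0" "u \<notin> real_multiples (- {0}) (lattice lam)" for u b
    using torus_line_dense[OF assms(1) that(2,3)] that(1) by simp
  show ?thesis
  proof (intro conjI impI)
    assume "a \<noteq> 0"
    show "\<exists>b. omega_limit lam T \<sigma> =
              torus_topology lam closure_of (torus_proj lam ` range (line (cnj a) b)) \<and>
            (cnj a \<in> real_multiples (- {0}) (lattice lam) - {0} \<longrightarrow>
               closed_curve lam T \<sigma> \<and> \<not> periodic_curve lam T \<sigma> \<and>
               support T \<sigma> = torus_proj lam ` range (line (cnj a) b)
               \<or>
               \<not> closed_curve lam T \<sigma> \<and>
               (\<exists>T' \<tau>. geodesic lam nabla T' \<tau> \<and> closed_curve lam T' \<tau> \<and>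
                  omega_limit lam T \<sigma> = support T' \<tau> \<and>
                  support T' \<tau> = torus_proj lam ` range (line (cnj a) b))) \<and>
            (cnj a \<notin> real_multiples (- {0}) (lattice lam) - {0} \<longrightarrow>
               omega_limit lam T \<sigma> = torus lam)"
    \<comment> \<open>For real \<open>a * v\<close> the geodesic lies on the line and can close up;
      otherwise it only approaches the line, which gives the second alternative.\<close>
    proof (cases "\<exists>p::real. a * v = of_real p")
      case True
      then obtain p :: real where p: "a * v = of_real p"
        by blast
      have "p \<noteq> 0"
        using p \<open>a \<noteq> 0\<close> \<open>v \<noteq> 0\<close> by auto
      have T: "T = (if p < 0 then ereal (- 1 / p) else \<infinity>)"
        using T_fin[OF _ p] T_inf p by (auto simp: of_real_eq_iff)
      have omega: "omega_limit lam T \<sigma> =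
          torus_topology lam closure_of (torus_proj lam ` range (line (cnj a) z0))"
        by (rule omega_limit_real_geodesic[OF assms(1) \<open>0 < T\<close> \<open>a \<noteq> 0\<close> \<open>p \<noteq> 0\<close> p T \<sigma>])
      have closed: "closed_curve lam T \<sigma> \<and> \<not> periodic_curve lam T \<sigma> \<and>
          support T \<sigma> = torus_proj lam ` range (line (cnj a) z0)"
        if mem: "cnj a \<in> real_multiples (- {0}) (lattice lam)"
      proof -
        obtain k where k: "k > 0" "cnj a * of_real k \<in> lattice lam"
          using real_multiples_latticeD[OF mem] .
        show ?thesis
          by (intro conjI
              closed_real_geodesic[OF assms(1) \<open>0 < T\<close> \<open>a \<noteq> 0\<close> \<open>p \<noteq> 0\<close> p T dom \<sigma> vel k])
      qed
      show ?thesis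
        using omega closed dense[OF omega] \<open>a \<noteq> 0\<close> by (intro exI[of _ z0]) simp
    next
      case False
      then have nonreal: "a * v \<noteq> of_real p" for p :: real
        by blast
      have T: "T = \<infinity>"
        using nonreal by (intro T_inf)
      have I: "t \<in> time_interval T \<longleftrightarrow> 0 \<le> t" for t
        by (simp add: T time_interval_def)
      \<comment> \<open>The limit of the convergent part of the lift, through which the asymptotic
        line passes.\<close>
      define b where "b = z0 + Ln (a * v) / a"
      have "a * v \<notin> \<real>\<^sub>\<le>\<^sub>0"
        using nonreal by (auto elim!: nonpos_Reals_cases)
      then have omega: "omega_limit lam T \<sigma> =
          torus_topology lam closure_of (torus_proj lam ` range (line (cnj a) b))"
        unfolding T b_def using \<sigma> dom I
        by (intro omega_limit_complete_geodesic[OF assms(1) \<open>a \<noteq> 0\<close>]) auto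
      \<comment> \<open>A return with factor \<open>c\<close> would give
        \<open>1 = c * (1 + a * v * l)\<close> and thus make \<open>a * v\<close> real.\<close>
      have not_closed: "\<not> closed_curve lam T \<sigma>"
      proof
        assume "closed_curve lam T \<sigma>"
        then obtain l c where l: "l \<in> time_interval T" "l > 0" "c > 0"
          "velocity lam T \<sigma> l = of_real c * velocity lam T \<sigma> 0"
          unfolding closed_curve_def by blast
        have "1 + a * v * of_real l \<noteq> 0"
          using dom[OF l(1)] by force
        then have "v = of_real c * v * (1 + a * v * of_real l)"
          using l(4) vel[OF l(1)] vel0 by (simp add: divide_eq_eq)
        then have "1 = of_real c * (1 + a * v * of_real l)"
          using \<open>v \<noteq> 0\<close> by (simp add: mult.commute mult.left_commute)
        then have "a * v = of_real ((1 - c) / (c * l))"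
          using l(2,3) by (simp add: field_simps)
        with nonreal show False
          by blast
      qed
      have limit_geodesic: "\<exists>T' \<tau>. geodesic lam nabla T' \<tau> \<and> closed_curve lam T' \<tau> \<and>
          omega_limit lam T \<sigma> = support T' \<tau> \<and>
          support T' \<tau> = torus_proj lam ` range (line (cnj a) b)"
        if mem: "cnj a \<in> real_multiples (- {0}) (lattice lam)"
      proof -
        obtain k where k: "k > 0" "cnj a * of_real k \<in> lattice lam"
          using real_multiples_latticeD[OF mem] .
        \<comment> \<open>The geodesic from \<open>b\<close> with initial velocity
          \<open>cnj a\<close>. As \<open>a * cnj a\<close> is a positive real, it exists for all
          time and runs along the line through \<open>b\<close>.\<close>
        define \<tau> where "\<tau> t = torus_proj lam (b + geodesic_lift a (cnj a) (of_real t))" for t :: real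
        define p where "p = (cmod a)\<^sup>2"
        have p: "a * cnj a = of_real p" "p > 0"
          unfolding p_def complex_norm_square using \<open>a \<noteq> 0\<close> by auto
        have dom': "1 + a * cnj a * of_real t \<notin> \<real>\<^sub>\<le>\<^sub>0" if "t \<in> time_interval \<infinity>" for t
          using that p by (intro one_plus_notin_nonpos_Reals) (auto simp: time_interval_def)
        have "(0::ereal) < \<infinity>"
          by simp
        note \<tau> = geodesic_geodesic_lift[OF assms(1,3) this dom' \<tau>_def]
        have "p \<noteq> 0" "\<infinity> = (if p < 0 then ereal (- 1 / p) else \<infinity>)"
          using p by auto
        note closed = closed_real_geodesic[OF assms(1) \<open>0 < \<infinity>\<close> \<open>a \<noteq> 0\<close> this(1) p(1) this(2)
            dom' \<tau>_def \<tau>(2) k]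
        have "omega_limit lam T \<sigma> = torus_proj lam ` range (line (cnj a) b)"
          using omega torus_line_closed[OF assms(1) k] by simp
        then show ?thesis
          using \<tau>(1) closed(1,3) by (intro exI[of _ \<infinity>] exI[of _ \<tau>]) simp
      qed
      show ?thesis
        using omega not_closed limit_geodesic dense[OF omega] \<open>a \<noteq> 0\<close> by (intro exI[of _ b]) simp
    qed
  next
    assume "a = 0"
    then have line: "\<sigma> t = torus_proj lam (line v z0 t)" if "t \<in> time_interval T" for t
      using \<sigma>[OF that] by (simp add: geodesic_lift_def line_def add.commute)
    have velt: "velocity lam T \<sigma> t = v" if "t \<in> time_interval T" for t
      using vel[OF that] \<open>a = 0\<close> by simp
    have T: "T = \<infinity>"
      using \<open>a = 0\<close> by (intro T_inf) auto
    have I: "t \<in> time_interval T \<longleftrightarrow> 0 \<le> t" for t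
      by (simp add: T time_interval_def)
    have returns: "\<sigma> l = \<sigma> 0 \<longleftrightarrow> v * of_real l \<in> lattice lam" if "0 \<le> l" for l
      using line[of l] line[of 0] that by (simp add: I torus_proj_eq_iff line_def)
    show "\<exists>b. \<forall>t \<in> time_interval T. \<sigma> t = torus_proj lam (line (velocity lam T \<sigma> 0) b t)"
      using line vel0 by auto
    {
      assume "velocity lam T \<sigma> 0 \<in> real_multiples {0<..} (lattice lam)"
      then obtain r x where r: "r > 0" "x \<in> lattice lam" "v = of_real r * x"
        unfolding vel0 real_multiples_def by auto
      \<comment> \<open>In time \<open>1 / r\<close> the straight motion is exactly the lattice
        vector \<open>x\<close>.\<close>
      then have "\<sigma> (1 / r) = \<sigma> 0"
        by (simp add: returns)
      then show "periodic_curve lam T \<sigma>"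
        unfolding periodic_curve_def using r by (intro bexI[of _ "1 / r"]) (auto simp: velt I)
      with velt show "closed_curve lam T \<sigma>"
        unfolding closed_curve_def periodic_curve_def
        by (metis mult_1 of_real_1 zero_less_one)
    }
    {
      assume not_mult: "velocity lam T \<sigma> 0 \<notin> real_multiples {0<..} (lattice lam)"
      have not_in: "v * of_real l \<notin> lattice lam" if "l > 0" for l
      proof
        assume "v * of_real l \<in> lattice lam"
        moreover have "v = of_real (1 / l) * (v * of_real l)" "1 / l \<in> {0<..}"
          using that by auto
        ultimately have "v \<in> real_multiples {0<..} (lattice lam)"
          unfolding real_multiples_def by blast
        with not_mult show False
          by (simp add: vel0)
      qed
      then show "\<not> closed_curve lam T \<sigma>"
        unfolding closed_curve_def using returns I by auto
      \<comment> \<open>Negative multiples are excluded as well: any nonzero real multiple of a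
        lattice vector has a positive period.\<close>
      have "v \<notin> real_multiples (- {0}) (lattice lam)"
        using real_multiples_latticeD not_in by metis
      moreover have "omega_limit lam T \<sigma> =
          torus_topology lam closure_of (torus_proj lam ` range (line v z0))"
      proof (rule omega_limit_asymptotic_line[OF assms(1) \<open>0 < T\<close> _ _ _ tendsto_const])
        show "\<sigma> t = torus_proj lam (v * of_real t + z0)" if "t \<in> time_interval T" for t
          using line[OF that] by (simp add: line_def)
        show "filterlim (\<lambda>t. t) at_top (time_end T)"
          by (simp add: T time_end_PInf filterlim_ident)
      qed (intro continuous_intros)
      ultimately show "omega_limit lam T \<sigma> = torus lam"
        using dense \<open>v \<noteq> 0\<close> by blast
    }
  qed
qed

end
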